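(* Suppose $1\le k\le\frac n2-\sqrt n$. There exist universal constants $C,c>0$ such that $$\inf_{\hat\theta}\ \sup_{\theta\in\mathbb{R},\ \|\gamma\|_0\le k}P_{\theta,\gamma}\left\{|\hat\theta-\theta|>C\frac kn\log^{-1/2}\Big(1+\frac{k^2(n-2k)^2}{n^3}\Big)\right\}\ge c,$$ where the infimum is over all estimators (measurable functions of $X_1,\dots,X_n$).
   Context: Model: for an integer $n\ge 2$, observations $X_j=\theta+\gamma_j+ Z_j$, $j=1,\dots,n$ (unit variance), where $\theta\in\mathbb{R}$, $\gamma\in\mathbb{R}^n$ and $Z_1,\dots,Z_n$ are i.i.d. $N(0,1)$; $P_{\theta,\gamma}$ denotes the joint law of $(X_1,\dots,X_n)$. $\|\gamma\|_0=\#\{j:\gamma_j\neq 0\}$. *)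

theory Defs
  imports "HOL-Probability.Probability"
begin

text \<open>Joint law P_{theta,gamma} of (X_1,...,X_n), X_j = theta + gamma_j + Z_j, Z_j iid N(0,1).
  Coordinates are indexed by {..<n}; sample points are (extensional) functions nat => real.\<close>
definition obs_law :: "nat \<Rightarrow> real \<Rightarrow> (nat \<Rightarrow> real) \<Rightarrow> (nat \<Rightarrow> real) measure" where
  "obs_law n \<theta> \<gamma> = PiM {..<n} (\<lambda>j. density lborel (normal_density (\<theta> + \<gamma> j) 1))"

definition l0norm :: "nat \<Rightarrow> (nat \<Rightarrow> real) \<Rightarrow> nat" where
  "l0norm n \<gamma> = card {j \<in> {..<n}. \<gamma> j \<noteq> 0}"

end

(*
  Le Cam's method with two fuzzy hypotheses, theta = 0 and theta = t. The contaminated means are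
  drawn independently, so that the coordinates have the mixture densities f and g.
  The difference g - f is a multiple, at most 2 (1 - 2 eps) with eps close to k / n, of the Gaussian
  smoothing of (delta_t - delta_0) - G, where G is a signed measure on [-M, M] of total variation
  at most 2 eps that has the same moments as delta_t - delta_0 up to order L. The remaining moments,
  of order l > L, contribute at most M^(2 l) / l! to the chi-square distance, so M^2 = L / 6 makes
  it of order eps^2 (1 - 2 eps)^2 / 2^L. With x = k^2 (n - 2 k)^2 / n^3 it is then O(1 / n) as soon
  as L is a large multiple of log (1 + x). Writing points of [-M, M] as M sin(s) turns
  polynomials of degree L into trigonometric ones, for which such a G exists when t is of order
  M eps / L, that is, eps / sqrt L. For bounded k or small x the rate is at most parametric and two
  uncontaminated Gaussians suffice.
*)

theory Submission
  imports Defs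
begin

section \<open>The contaminated Gaussian model\<close>

abbreviation \<phi> :: "real \<Rightarrow> real \<Rightarrow> real" where
  "\<phi> u \<equiv> normal_density u 1"

abbreviation lborel_pow :: "nat \<Rightarrow> (nat \<Rightarrow> real) measure" where
  "lborel_pow n \<equiv> PiM {..<n} (\<lambda>_. lborel)"

lemma product_sigma_finite_lborel: "product_sigma_finite (\<lambda>_ :: nat. lborel :: real measure)"
  by (simp add: product_sigma_finite_def lborel.sigma_finite_measure_axioms)

text \<open>Two product measures that agree on boxes coincide, and on a box the integral of a
  product of densities factorises. The common dominating measure \<open>lborel_pow n\<close> lets
  averages over priors and comparisons of laws be carried out on densities.\<close>

lemma obs_law_eq_density:
  "obs_law n \<theta> \<gamma> = density (lborel_pow n) (\<lambda>x. ennreal (\<Prod>j<n. \<phi> (\<theta> + \<gamma> j) (x j)))"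
proof -
  interpret P: product_sigma_finite "\<lambda>_ :: nat. lborel :: real measure"
    by (rule product_sigma_finite_lborel)
  interpret Q: product_prob_space "\<lambda>j :: nat. density lborel (\<lambda>x. ennreal (\<phi> (\<theta> + \<gamma> j) x))"
    by (auto simp: product_prob_space_def product_sigma_finite_def product_prob_space_axioms_def
        prob_space_normal_density intro: prob_space_imp_sigma_finite)
  have "density (lborel_pow n) (\<lambda>x. ennreal (\<Prod>j<n. \<phi> (\<theta> + \<gamma> j) (x j)))
      = PiM {..<n} (\<lambda>j. density lborel (\<lambda>x. ennreal (\<phi> (\<theta> + \<gamma> j) x)))"
  proof (rule Q.PiM_eqI)
    fix A :: "nat \<Rightarrow> real set"
    assume A: "\<And>i. i \<in> {..<n} \<Longrightarrow> A i \<in> sets (density lborel (\<lambda>x. ennreal (\<phi> (\<theta> + \<gamma> i) x)))"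
    then have A': "\<And>i. i < n \<Longrightarrow> A i \<in> sets borel" by auto
    have meas: "PiE {..<n} A \<in> sets (lborel_pow n)"
      using A' by (intro sets_PiM_I_finite) auto
    have "emeasure (density (lborel_pow n) (\<lambda>x. ennreal (\<Prod>j<n. \<phi> (\<theta> + \<gamma> j) (x j)))) (PiE {..<n} A)
      = (\<integral>\<^sup>+x. ennreal (\<Prod>j<n. \<phi> (\<theta> + \<gamma> j) (x j)) * indicator (PiE {..<n} A) x \<partial>lborel_pow n)"
      using meas by (subst emeasure_density) auto
    also have "\<dots> = (\<integral>\<^sup>+x. (\<Prod>j<n. ennreal (\<phi> (\<theta> + \<gamma> j) (x j)) * indicator (A j) (x j)) \<partial>lborel_pow n)"
    proof (intro nn_integral_cong)
      fix x :: "nat \<Rightarrow> real" assume "x \<in> space (lborel_pow n)"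
      then have "indicator (PiE {..<n} A) x = (\<Prod>j<n. indicator (A j) (x j) :: ennreal)"
        by (auto simp: space_PiM indicator_def PiE_iff split: if_splits)
      then show "ennreal (\<Prod>j<n. \<phi> (\<theta> + \<gamma> j) (x j)) * indicator (PiE {..<n} A) x
        = (\<Prod>j<n. ennreal (\<phi> (\<theta> + \<gamma> j) (x j)) * indicator (A j) (x j))"
        by (simp add: prod.distrib prod_ennreal)
    qed
    also have "\<dots> = (\<Prod>j<n. \<integral>\<^sup>+y. ennreal (\<phi> (\<theta> + \<gamma> j) y) * indicator (A j) y \<partial>lborel)"
      using A' by (intro P.product_nn_integral_prod) auto
    also have "\<dots> = (\<Prod>j<n. emeasure (density lborel (\<lambda>x. ennreal (\<phi> (\<theta> + \<gamma> j) x))) (A j))"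
      using A' by (intro prod.cong refl, subst emeasure_density) auto
    finally show "emeasure (density (lborel_pow n) (\<lambda>x. ennreal (\<Prod>j<n. \<phi> (\<theta> + \<gamma> j) (x j)))) (PiE {..<n} A)
      = (\<Prod>j<n. emeasure (density lborel (\<lambda>x. ennreal (\<phi> (\<theta> + \<gamma> j) x))) (A j))" .
  next
    show "sets (density (lborel_pow n) (\<lambda>x. ennreal (\<Prod>j<n. \<phi> (\<theta> + \<gamma> j) (x j))))
      = sets (PiM {..<n} (\<lambda>j. density lborel (\<lambda>x. ennreal (\<phi> (\<theta> + \<gamma> j) x))))"
      by (simp, intro sets_PiM_cong) auto
  qed auto
  then show ?thesis by (simp add: obs_law_def)
qed

lemma prob_space_obs_law: "prob_space (obs_law n \<theta> \<gamma>)"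
  unfolding obs_law_def by (intro prob_space_PiM prob_space_normal_density) simp

lemma sets_obs_law: "sets (obs_law n \<theta> \<gamma>) = sets (lborel_pow n)"
  and space_obs_law: "space (obs_law n \<theta> \<gamma>) = space (lborel_pow n)"
  by (simp_all add: obs_law_eq_density)

lemma integrable_prod_lborel_pow:
  fixes f :: "real \<Rightarrow> real"
  assumes "integrable lborel f"
  shows "integrable (lborel_pow n) (\<lambda>x. \<Prod>j<n. f (x j))"
    and "(\<integral>x. (\<Prod>j<n. f (x j)) \<partial>lborel_pow n) = (\<integral>y. f y \<partial>lborel) ^ n"
proof -
  interpret P: product_sigma_finite "\<lambda>_ :: nat. lborel :: real measure"
    by (rule product_sigma_finite_lborel)
  show "integrable (lborel_pow n) (\<lambda>x. \<Prod>j<n. f (x j))"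
    using assms by (intro P.product_integrable_prod) auto
  show "(\<integral>x. (\<Prod>j<n. f (x j)) \<partial>lborel_pow n) = (\<integral>y. f y \<partial>lborel) ^ n"
    using assms by (subst P.product_integral_prod) auto
qed

lemma integrable_prod_normal_density:
  "integrable (lborel_pow n) (\<lambda>x. \<Prod>j<n. \<phi> (v j) (x j))"
proof -
  interpret P: product_sigma_finite "\<lambda>_ :: nat. lborel :: real measure"
    by (rule product_sigma_finite_lborel)
  show ?thesis by (intro P.product_integrable_prod) auto
qed

lemma measure_obs_law:
  assumes "A \<in> sets (lborel_pow n)"
  shows "measure (obs_law n \<theta> \<gamma>) A
    = (\<integral>x. indicator A x * (\<Prod>j<n. \<phi> (\<theta> + \<gamma> j) (x j)) \<partial>lborel_pow n)"
proof -
  have "measure (obs_law n \<theta> \<gamma>) A = (\<integral>x. indicator A x \<partial>obs_law n \<theta> \<gamma>)"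
    using assms sets.sets_into_space[OF assms]
    by (simp add: space_obs_law Int_absorb2)
  also have "\<dots> = (\<integral>x. (\<Prod>j<n. \<phi> (\<theta> + \<gamma> j) (x j)) * indicator A x \<partial>lborel_pow n)"
    unfolding obs_law_eq_density using assms
    by (subst integral_density) (auto intro!: prod_nonneg AE_I2)
  finally show ?thesis by (simp add: mult.commute)
qed

text \<open>The prior puts weight \<open>p i\<close> on the mean \<open>u i\<close> independently in every coordinate.  The event
  that more than \<open>k\<close> coordinates are contaminated is removed by Chernoff's bound with the
  weight \<open>(1 + h)\<close> per contaminated coordinate.\<close>

lemma mixture_prob_le:
  fixes p u :: "'i \<Rightarrow> real"
  assumes fin: "finite I" and p: "\<And>i. i \<in> I \<Longrightarrow> 0 \<le> p i" and psum: "sum p I = 1"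
    and A: "A \<in> sets (lborel_pow n)"
    and S: "\<And>\<gamma>. l0norm n \<gamma> \<le> k \<Longrightarrow> measure (obs_law n \<theta> \<gamma>) A \<le> S"
    and cont: "sum p {i \<in> I. u i \<noteq> \<theta>} \<le> \<epsilon>" and h: "0 \<le> h"
    and chernoff: "7 * (1 + \<epsilon> * h) ^ n \<le> (1 + h) ^ k"
  shows "(\<integral>x. indicator A x * (\<Prod>j<n. \<Sum>i\<in>I. p i * \<phi> (u i) (x j)) \<partial>lborel_pow n) \<le> S + 1 / 7"
proof -
  define W where "W s = (\<Prod>j<n. p (s j))" for s
  define g where "g s j = u (s j) - \<theta>" for s :: "nat \<Rightarrow> 'i" and j
  define T where "T = PiE {..<n} (\<lambda>_. I)"
  define N where "N s = l0norm n (g s)" for s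
  have finT: "finite T" unfolding T_def using fin by (intro finite_PiE) auto
  have W0: "0 \<le> W s" if "s \<in> T" for s
    unfolding W_def using that p by (intro prod_nonneg) (auto simp: T_def)
  have S0: "0 \<le> S"
    by (rule order_trans[OF measure_nonneg S[of "\<lambda>_. 0"]]) (simp add: l0norm_def)
  have Wsum: "sum W T = 1"
    unfolding W_def T_def using prod_sum_PiE[of "{..<n}" "\<lambda>_. I" "\<lambda>_. p"] fin psum by simp
  \<comment> \<open>Expanding the product of sums over all assignments \<open>s\<close> of support
    points to coordinates turns the mixture into an average, with weights \<open>W s\<close>, of
    laws of the model with fixed shifts \<open>g s\<close>.\<close>
  have "(\<integral>x. indicator A x * (\<Prod>j<n. \<Sum>i\<in>I. p i * \<phi> (u i) (x j)) \<partial>lborel_pow n)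
      = (\<integral>x. (\<Sum>s\<in>T. W s * (indicator A x * (\<Prod>j<n. \<phi> (u (s j)) (x j)))) \<partial>lborel_pow n)"
    unfolding T_def W_def using fin
    by (intro Bochner_Integration.integral_cong refl)
      (simp add: prod_sum_PiE prod.distrib sum_distrib_left mult_ac)
  also have "\<dots> = (\<Sum>s\<in>T. W s * (\<integral>x. indicator A x * (\<Prod>j<n. \<phi> (u (s j)) (x j)) \<partial>lborel_pow n))"
    using A by (subst Bochner_Integration.integral_sum)
      (auto intro!: integrable_mult_indicator[where 'b=real, unfolded real_scaleR_def] integrable_prod_normal_density)
  also have "\<dots> = (\<Sum>s\<in>T. W s * measure (obs_law n \<theta> (g s)) A)"
    using A by (simp add: measure_obs_law g_def)
  also have "\<dots> \<le> (\<Sum>s\<in>T. W s * (S + (1 + h) ^ N s / (1 + h) ^ k))"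
  proof (intro sum_mono mult_left_mono W0)
    fix s
    show "measure (obs_law n \<theta> (g s)) A \<le> S + (1 + h) ^ N s / (1 + h) ^ k"
    proof (cases "N s \<le> k")
      case True
      then have "measure (obs_law n \<theta> (g s)) A \<le> S" using S by (simp add: N_def)
      moreover have "0 \<le> (1 + h) ^ N s / (1 + h) ^ k" using h by simp
      ultimately show ?thesis by linarith
    next
      case False
      then have "(1 + h) ^ k \<le> (1 + h) ^ N s" using h by (intro power_increasing) auto
      then have "1 \<le> (1 + h) ^ N s / (1 + h) ^ k" using h by (simp add: field_simps)
      moreover have "measure (obs_law n \<theta> (g s)) A \<le> 1"
        by (rule prob_space.prob_le_1[OF prob_space_obs_law])
      ultimately show ?thesis using S0 by linarith
    qed
  qed
  also have "\<dots> = S + (\<Sum>s\<in>T. W s * (1 + h) ^ N s) / (1 + h) ^ k"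
    using Wsum by (simp add: distrib_left sum.distrib sum_divide_distrib flip: sum_distrib_right)
  \<comment> \<open>The exponential moment of the number of contaminated coordinates factorises:
    each such coordinate brings its own factor \<open>1 + h\<close>.\<close>
  also have "(\<Sum>s\<in>T. W s * (1 + h) ^ N s)
      = (\<Sum>s\<in>T. \<Prod>j<n. p (s j) * (if u (s j) \<noteq> \<theta> then 1 + h else 1))"
  proof (intro sum.cong refl)
    fix s
    have "(\<Prod>j<n. if u (s j) \<noteq> \<theta> then 1 + h else 1) = (\<Prod>j\<in>{j\<in>{..<n}. u (s j) \<noteq> \<theta>}. 1 + h)"
      by (rule prod.inter_filter[symmetric]) simp
    also have "\<dots> = (1 + h) ^ N s" by (simp add: N_def l0norm_def g_def)
    finally show "W s * (1 + h) ^ N s = (\<Prod>j<n. p (s j) * (if u (s j) \<noteq> \<theta> then 1 + h else 1))"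
      by (simp add: prod.distrib W_def)
  qed
  also have "\<dots> = (\<Sum>i\<in>I. p i * (if u i \<noteq> \<theta> then 1 + h else 1)) ^ n"
    unfolding T_def
    using prod_sum_PiE[of "{..<n}" "\<lambda>_. I" "\<lambda>_ i. p i * (if u i \<noteq> \<theta> then 1 + h else 1)"] fin by simp
  also have "(\<Sum>i\<in>I. p i * (if u i \<noteq> \<theta> then 1 + h else 1)) = (\<Sum>i\<in>I. p i + h * (if u i \<noteq> \<theta> then p i else 0))"
    by (intro sum.cong refl) (auto simp: algebra_simps)
  also have "\<dots> = 1 + h * sum p {i \<in> I. u i \<noteq> \<theta>}"
    using fin psum by (simp add: sum.distrib sum.inter_filter flip: sum_distrib_left)
  finally have "(\<integral>x. indicator A x * (\<Prod>j<n. \<Sum>i\<in>I. p i * \<phi> (u i) (x j)) \<partial>lborel_pow n)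
      \<le> S + (1 + h * sum p {i \<in> I. u i \<noteq> \<theta>}) ^ n / (1 + h) ^ k" .
  moreover have "(1 + h * sum p {i \<in> I. u i \<noteq> \<theta>}) ^ n \<le> (1 + \<epsilon> * h) ^ n"
    using p h cont by (intro power_mono) (auto simp: mult.commute[of \<epsilon>] intro!: mult_left_mono add_nonneg_nonneg mult_nonneg_nonneg sum_nonneg)
  moreover have "(1 + \<epsilon> * h) ^ n / (1 + h) ^ k \<le> 1 / 7"
    using chernoff h by (simp add: field_simps)
  ultimately show ?thesis using h
    by (smt (verit) divide_right_mono zero_le_power)
qed

section \<open>Le Cam's method for mixtures\<close>

text \<open>Completing the square in the exponent. After division by \<open>\<phi> 0 z\<close> and
  integration only \<open>exp (u * v)\<close> is left, which is the kernel of the chi-square form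
  below.\<close>

lemma normal_density_cross: "\<phi> u z * \<phi> v z = exp (u * v) * \<phi> (u + v) z * \<phi> 0 z"
  by (simp add: normal_density_def power2_eq_square field_simps flip: exp_add)

text \<open>The atom at 0 has weight at least 1/2, so \<open>f\<close> dominates half of
  \<open>\<phi> 0\<close>. Passing to the denominator \<open>\<phi> 0\<close> costs a factor 2 and
  makes the chi-square distance an explicit quadratic form in \<open>q - p\<close>.\<close>

lemma mixture_chi_square:
  fixes p q u :: "'i \<Rightarrow> real"
  assumes fin: "finite I" and p: "\<And>i. i \<in> I \<Longrightarrow> 0 \<le> p i" and psum: "sum p I = 1"
    and qsum: "sum q I = 1"
    and o: "i0 \<in> I" "u i0 = 0" "1 / 2 \<le> p i0"
  defines "f \<equiv> \<lambda>z. \<Sum>i\<in>I. p i * \<phi> (u i) z" and "g \<equiv> \<lambda>z. \<Sum>i\<in>I. q i * \<phi> (u i) z"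
  shows "\<And>z. 0 < f z" "integrable lborel (\<lambda>z. (g z)\<^sup>2 / f z)"
    "(\<integral>z. (g z)\<^sup>2 / f z \<partial>lborel)
      \<le> 1 + 2 * (\<Sum>i\<in>I. \<Sum>j\<in>I. (q i - p i) * (q j - p j) * exp (u i * u j))"
proof -
  have f_ge: "\<phi> 0 z / 2 \<le> f z" for z
  proof -
    have "\<phi> 0 z / 2 \<le> p i0 * \<phi> (u i0) z"
      using mult_right_mono[OF o(3), of "\<phi> 0 z"] o(2) by simp
    also have "\<dots> \<le> f z"
      unfolding f_def using fin o p by (intro member_le_sum) auto
    finally show ?thesis .
  qed
  show f_pos: "0 < f z" for z
    using f_ge[of z] normal_density_pos[of 1 0 z] by linarith
  define H where "H z = (\<Sum>i\<in>I. \<Sum>j\<in>I. (q i - p i) * (q j - p j) * exp (u i * u j) * \<phi> (u i + u j) z)" for z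
  have intH: "integrable lborel H" unfolding H_def by auto
  have intf: "integrable lborel f" and intg: "integrable lborel g" unfolding f_def g_def by auto
  have H_eq: "(g z - f z)\<^sup>2 / \<phi> 0 z = H z" for z
  proof -
    have "g z - f z = (\<Sum>i\<in>I. (q i - p i) * \<phi> (u i) z)"
      unfolding f_def g_def by (simp add: sum_subtractf left_diff_distrib)
    then have "(g z - f z)\<^sup>2 = (\<Sum>i\<in>I. \<Sum>j\<in>I. (q i - p i) * (q j - p j) * (\<phi> (u i) z * \<phi> (u j) z))"
      by (simp add: power2_eq_square sum_product mult_ac)
    also have "\<dots> = H z * \<phi> 0 z"
      unfolding H_def normal_density_cross sum_distrib_right by (simp add: mult_ac)
    finally show ?thesis using normal_density_pos[of 1 0 z] by simp
  qed
  have le: "(g z)\<^sup>2 / f z \<le> 2 * H z + 2 * g z - f z" for z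
  proof -
    have "(g z - f z)\<^sup>2 / f z \<le> (g z - f z)\<^sup>2 / (\<phi> 0 z / 2)"
      using f_ge[of z] normal_density_pos[of 1 0 z] f_pos[of z] by (intro divide_left_mono) auto
    then have "(g z - f z)\<^sup>2 / f z \<le> 2 * H z" by (simp add: mult.commute flip: H_eq)
    moreover have "(g z)\<^sup>2 / f z = (g z - f z)\<^sup>2 / f z + 2 * g z - f z"
      using f_pos[of z] by (simp add: field_simps power2_eq_square)
    ultimately show ?thesis by simp
  qed
  show int: "integrable lborel (\<lambda>z. (g z)\<^sup>2 / f z)"
  proof (rule Bochner_Integration.integrable_bound)
    show "integrable lborel (\<lambda>z. 2 * H z + 2 * g z - f z)"
      using intH intf intg by auto
    show "(\<lambda>z. (g z)\<^sup>2 / f z) \<in> borel_measurable lborel"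
      using intf intg by measurable
    show "AE z in lborel. norm ((g z)\<^sup>2 / f z) \<le> norm (2 * H z + 2 * g z - f z)"
    proof (rule AE_I2)
      fix z
      have "0 \<le> (g z)\<^sup>2 / f z" using f_pos[of z] by simp
      with le[of z] show "norm ((g z)\<^sup>2 / f z) \<le> norm (2 * H z + 2 * g z - f z)" by simp
    qed
  qed
  have "(\<integral>z. (g z)\<^sup>2 / f z \<partial>lborel) \<le> (\<integral>z. 2 * H z + 2 * g z - f z \<partial>lborel)"
    using intH intf intg int le by (intro integral_mono) auto
  also have "\<dots> = 2 * (\<integral>z. H z \<partial>lborel) + 2 * (\<integral>z. g z \<partial>lborel) - (\<integral>z. f z \<partial>lborel)"
    using intH intf intg by simp
  also have "(\<integral>z. H z \<partial>lborel) = (\<Sum>i\<in>I. \<Sum>j\<in>I. (q i - p i) * (q j - p j) * exp (u i * u j))"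
    unfolding H_def by simp
  also have "(\<integral>z. g z \<partial>lborel) = 1" unfolding g_def using qsum by simp
  also have "(\<integral>z. f z \<partial>lborel) = 1" unfolding f_def using psum by simp
  finally show "(\<integral>z. (g z)\<^sup>2 / f z \<partial>lborel)
      \<le> 1 + 2 * (\<Sum>i\<in>I. \<Sum>j\<in>I. (q i - p i) * (q j - p j) * exp (u i * u j))" by simp
qed

text \<open>Pointwise, \<open>F - G \<le> F / 10 + 5 / 2 * (F - G)\<^sup>2 / F\<close> by AM-GM, so the total variation
  distance is controlled by the chi-square distance without passing to square roots.\<close>

lemma product_tv_le:
  fixes f g :: "real \<Rightarrow> real"
  assumes f: "integrable lborel f" "(\<integral>z. f z \<partial>lborel) = 1" "\<And>z. 0 < f z"
    and g: "integrable lborel g" "(\<integral>z. g z \<partial>lborel) = 1"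
    and gf: "integrable lborel (\<lambda>z. (g z)\<^sup>2 / f z)" "(\<integral>z. (g z)\<^sup>2 / f z \<partial>lborel) \<le> 1 + x"
    and x: "real n * x \<le> 1 / 64" and A: "A \<in> sets (lborel_pow n)"
  shows "(\<integral>z. indicator A z * (\<Prod>j<n. f (z j)) \<partial>lborel_pow n)
    \<le> (\<integral>z. indicator A z * (\<Prod>j<n. g (z j)) \<partial>lborel_pow n) + 9 / 50"
proof -
  define F where "F z = (\<Prod>j<n. f (z j))" for z :: "nat \<Rightarrow> real"
  define G where "G z = (\<Prod>j<n. g (z j))" for z :: "nat \<Rightarrow> real"
  define R where "R z = (\<Prod>j<n. (g (z j))\<^sup>2 / f (z j))" for z :: "nat \<Rightarrow> real"
  note int = integrable_prod_lborel_pow[OF f(1), of n, folded F_def]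
    integrable_prod_lborel_pow[OF g(1), of n, folded G_def]
    integrable_prod_lborel_pow[OF gf(1), of n, folded R_def]
  have F_pos: "0 < F z" for z unfolding F_def using f(3) by (intro prod_pos) auto
  have R_eq: "R z = (G z)\<^sup>2 / F z" for z
    by (simp add: R_def G_def F_def prod_dividef prod_power_distrib)
  \<comment> \<open>The second moment of the likelihood ratio multiplies over coordinates, so a
    one-coordinate excess \<open>x\<close> becomes at most \<open>exp (n * x) - 1\<close> for the
    sample.\<close>
  have "(\<integral>z. (g z)\<^sup>2 / f z \<partial>lborel) ^ n \<le> exp x ^ n"
  proof (rule power_mono)
    show "(\<integral>z. (g z)\<^sup>2 / f z \<partial>lborel) \<le> exp x"
      using gf(2) exp_ge_add_one_self[of x] by linarith
    show "0 \<le> (\<integral>z. (g z)\<^sup>2 / f z \<partial>lborel)"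
      using f(3) by (intro Bochner_Integration.integral_nonneg) (simp add: less_imp_le)
  qed
  also have "\<dots> = exp (real n * x)" by (simp add: exp_of_nat_mult)
  also have "\<dots> \<le> exp (1 / 64)" using x by simp
  also have "\<dots> \<le> 1 + 2 * (1 / 64 :: real)"
    by (rule real_exp_bound_lemma) auto
  finally have R_int: "(\<integral>z. R z \<partial>lborel_pow n) \<le> 1 + 1 / 32" using int(6) by simp
  have intA: "integrable (lborel_pow n) (\<lambda>z. indicator A z * F z)"
    "integrable (lborel_pow n) (\<lambda>z. indicator A z * G z)"
    using int A by (auto intro!: integrable_mult_indicator[where 'b=real, unfolded real_scaleR_def])
  have "(\<integral>z. indicator A z * F z \<partial>lborel_pow n) - (\<integral>z. indicator A z * G z \<partial>lborel_pow n)
      = (\<integral>z. indicator A z * F z - indicator A z * G z \<partial>lborel_pow n)"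
    using intA by simp
  also have "\<dots> \<le> (\<integral>z. F z / 10 + 5 / 2 * (R z - 2 * G z + F z) \<partial>lborel_pow n)"
  proof (intro integral_mono)
    fix z
    \<comment> \<open>The first bound is used on \<open>A\<close>; the second, nonnegativity, is
      what the points outside \<open>A\<close> require.\<close>
    have "F z - G z \<le> F z / 10 + 5 / 2 * (R z - 2 * G z + F z)"
      and "0 \<le> F z / 10 + 5 / 2 * (R z - 2 * G z + F z)"
    proof -
      have *: "R z - 2 * G z + F z = F z * ((G z / F z - 1))\<^sup>2"
        using F_pos[of z] by (simp add: R_eq power2_eq_square field_simps)
      \<comment> \<open>With \<open>D = G / F - 1\<close> the square expands to
        \<open>5/2 * D^2 + D + 1/10\<close>, and \<open>F * D = G - F\<close>.\<close>
      have "0 \<le> F z * (5 / 2 * (G z / F z - 1 + 1 / 5)\<^sup>2)"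
        using F_pos[of z] by (simp add: less_imp_le)
      also have "\<dots> = F z / 10 + 5 / 2 * (F z * ((G z / F z - 1))\<^sup>2) - (F z - G z)"
        using F_pos[of z] by (simp add: power2_eq_square field_simps)
      finally show "F z - G z \<le> F z / 10 + 5 / 2 * (R z - 2 * G z + F z)" unfolding * by simp
      show "0 \<le> F z / 10 + 5 / 2 * (R z - 2 * G z + F z)"
        unfolding * using F_pos[of z] by (simp add: less_imp_le)
    qed
    then show "indicator A z * F z - indicator A z * G z \<le> F z / 10 + 5 / 2 * (R z - 2 * G z + F z)"
      by (simp add: indicator_def)
  qed (use intA int in auto)
  also have "\<dots> = 1 / 10 + 5 / 2 * ((\<integral>z. R z \<partial>lborel_pow n) - 2 + 1)"
    using int f(2) g(2) by simp
  also have "\<dots> \<le> 9 / 50" using R_int by simp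
  finally show ?thesis unfolding F_def G_def by simp
qed

section \<open>Worst-case risk and its lower bound from two priors\<close>

definition risk :: "nat \<Rightarrow> nat \<Rightarrow> ((nat \<Rightarrow> real) \<Rightarrow> real) \<Rightarrow> real \<Rightarrow> real" where
  "risk n k T r = (SUP p \<in> {(\<theta>, \<gamma>) | \<theta> \<gamma>. l0norm n \<gamma> \<le> k}.
     measure (obs_law n (fst p) (snd p)) {x \<in> space (obs_law n (fst p) (snd p)). r < \<bar>T x - fst p\<bar>})"

text \<open>Probabilities are bounded by 1, so the real-valued supremum really is an upper bound of
  its family.\<close>

lemma le_risk:
  assumes "l0norm n \<gamma> \<le> k"
  shows "measure (obs_law n \<theta> \<gamma>) {x \<in> space (lborel_pow n). r < \<bar>T x - \<theta>\<bar>} \<le> risk n k T r"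
proof -
  let ?f = "\<lambda>p. measure (obs_law n (fst p) (snd p))
    {x \<in> space (obs_law n (fst p) (snd p)). r < \<bar>T x - fst p\<bar>}"
  have "bdd_above (?f ` {(\<theta>, \<gamma>) | \<theta> \<gamma>. l0norm n \<gamma> \<le> k})"
    by (rule bdd_aboveI2[of _ _ 1]) (rule prob_space.prob_le_1[OF prob_space_obs_law])
  then have "?f (\<theta>, \<gamma>) \<le> risk n k T r"
    unfolding risk_def using assms by (intro cSUP_upper) auto
  then show ?thesis by (simp add: space_obs_law)
qed

text \<open>The mixture \<open>p\<close> is regarded as a contamination of the mean \<open>0\<close>, and \<open>q\<close>, which has the same
  support points, as a contamination of the mean \<open>t\<close>.\<close>

lemma risk_ge_two_mixtures:
  fixes p q u :: "'i \<Rightarrow> real"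
  assumes fin: "finite I" and p: "\<And>i. i \<in> I \<Longrightarrow> 0 \<le> p i" and psum: "sum p I = 1"
    and q: "\<And>i. i \<in> I \<Longrightarrow> 0 \<le> q i" and qsum: "sum q I = 1"
    and o: "i0 \<in> I" "u i0 = 0" "1 / 2 \<le> p i0"
    and pcont: "sum p {i \<in> I. u i \<noteq> 0} \<le> \<epsilon>" and qcont: "sum q {i \<in> I. u i \<noteq> t} \<le> \<epsilon>"
    and h: "0 \<le> h" and chernoff: "7 * (1 + \<epsilon> * h) ^ n \<le> (1 + h) ^ k"
    and chi: "real n * (2 * (\<Sum>i\<in>I. \<Sum>j\<in>I. (q i - p i) * (q j - p j) * exp (u i * u j))) \<le> 1 / 64"
    and t: "2 * r < t" and T: "T \<in> borel_measurable (lborel_pow n)"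
  shows "1 / 4 \<le> risk n k T r"
proof -
  define f where "f z = (\<Sum>i\<in>I. p i * \<phi> (u i) z)" for z
  define g where "g z = (\<Sum>i\<in>I. q i * \<phi> (u i) z)" for z
  define F where "F z = (\<Prod>j<n. f (z j))" for z :: "nat \<Rightarrow> real"
  define G where "G z = (\<Prod>j<n. g (z j))" for z :: "nat \<Rightarrow> real"
  define A where "A \<theta> = {x \<in> space (lborel_pow n). r < \<bar>T x - \<theta>\<bar>}" for \<theta>
  have A: "A \<theta> \<in> sets (lborel_pow n)" for \<theta> unfolding A_def using T by measurable
  note chi_square = mixture_chi_square[where p = p and q = q and u = u, OF fin p psum qsum o, folded f_def g_def]
  have intf: "integrable lborel f" and intg: "integrable lborel g" unfolding f_def g_def by auto
  have If: "(\<integral>z. f z \<partial>lborel) = 1" and Ig: "(\<integral>z. g z \<partial>lborel) = 1"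
    unfolding f_def g_def using psum qsum by simp_all
  note intF = integrable_prod_lborel_pow[OF intf, of n, folded F_def]
  have F0: "0 \<le> F z" for z unfolding F_def using chi_square(1) by (intro prod_nonneg) (auto intro: less_imp_le)
  \<comment> \<open>Since \<open>t > 2 * r\<close>, no estimate is within \<open>r\<close> of both 0
    and \<open>t\<close>, so \<open>A 0\<close> and \<open>A t\<close> cover the sample
    space.\<close>
  have "1 = (\<integral>z. F z \<partial>lborel_pow n)" using intF If by simp
  also have "\<dots> \<le> (\<integral>z. indicator (A 0) z * F z + indicator (A t) z * F z \<partial>lborel_pow n)"
  proof (intro integral_mono)
    fix z assume "z \<in> space (lborel_pow n)"
    then have "z \<in> A 0 \<or> z \<in> A t" unfolding A_def using t by auto
    then show "F z \<le> indicator (A 0) z * F z + indicator (A t) z * F z"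
      using F0[of z] by (auto simp: indicator_def)
  qed (use A intF in \<open>auto intro!: integrable_mult_indicator[where 'b=real, unfolded real_scaleR_def] Bochner_Integration.integrable_add\<close>)
  also have "\<dots> = (\<integral>z. indicator (A 0) z * F z \<partial>lborel_pow n) + (\<integral>z. indicator (A t) z * F z \<partial>lborel_pow n)"
    using A intF by (intro Bochner_Integration.integral_add)
      (auto intro!: integrable_mult_indicator[where 'b=real, unfolded real_scaleR_def])
  also have "(\<integral>z. indicator (A 0) z * F z \<partial>lborel_pow n) \<le> risk n k T r + 1 / 7"
    unfolding F_def f_def
    by (intro mixture_prob_le[OF fin p psum A _ pcont h chernoff]) (assumption, unfold A_def, rule le_risk)
  also have "(\<integral>z. indicator (A t) z * F z \<partial>lborel_pow n) \<le> (\<integral>z. indicator (A t) z * G z \<partial>lborel_pow n) + 9 / 50"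
    unfolding F_def G_def
    by (rule product_tv_le[OF intf If chi_square(1) intg Ig chi_square(2,3) chi A]) auto
  also have "(\<integral>z. indicator (A t) z * G z \<partial>lborel_pow n) \<le> risk n k T r + 1 / 7"
    unfolding G_def g_def
    by (intro mixture_prob_le[OF fin q qsum A _ qcont h chernoff]) (assumption, unfold A_def, rule le_risk)
  \<comment> \<open>The chain reads \<open>1 <= 2 * risk + 2/7 + 9/50\<close>, which leaves slightly
    more than 1/4 for the risk.\<close>
  finally show ?thesis by simp
qed

section \<open>Moment matching by trigonometric interpolation\<close>

text \<open>A geometric sum in an \<open>N\<close>-th root of unity \<open>z\<close>: either
  \<open>z = 1\<close>, or the numerator \<open>1 - z ^ N\<close> of the closed form
  vanishes.\<close>

lemma sum_cis_roots:
  assumes N: "0 < N"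
  shows "(\<Sum>j<N. cis (of_int d * (2 * pi * real j / real N))) = (if int N dvd d then of_nat N else 0)"
proof -
  define z where "z = cis (2 * pi * (of_int d / real N))"
  have pow: "cis (of_int d * (2 * pi * real j / real N)) = z ^ j" for j
  proof -
    have "of_int d * (2 * pi * real j / real N) = real j * (2 * pi * (of_int d / real N))" by simp
    then show ?thesis by (simp only: z_def Complex.DeMoivre)
  qed
  show ?thesis
  proof (cases "int N dvd d")
    case True
    then obtain e where "d = int N * e" by auto
    then have "z = 1" using N by (simp add: z_def)
    then show ?thesis unfolding pow using True by simp
  next
    case False
    have "z \<noteq> 1"
    proof
      assume "z = 1"
      then have "cos (2 * pi * (of_int d / real N)) = 1" by (simp add: z_def complex_eq_iff)
      then obtain m :: int where "2 * pi * (of_int d / real N) = of_int m * 2 * pi"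
        by (auto simp: cos_one_2pi_int)
      then have "of_int d = real_of_int (m * int N)" using N by (simp add: field_simps)
      then show False using False by (metis dvd_triv_right of_int_eq_iff)
    qed
    moreover have "z ^ N = 1"
    proof -
      have "real N * (2 * pi * (of_int d / real N)) = 2 * pi * of_int d" using N by simp
      then have "z ^ N = cis (2 * pi * of_int d)" by (simp only: z_def Complex.DeMoivre)
      then show ?thesis by simp
    qed
    ultimately show ?thesis unfolding pow using False by (simp add: sum_gp_strict)
  qed
qed

lemma sum_cis_roots_less:
  assumes "0 < N" "\<bar>d\<bar> < int N"
  shows "(\<Sum>j<N. cis (of_int d * (2 * pi * real j / real N))) = (if d = 0 then of_nat N else 0)"
  using sum_cis_roots[OF assms(1), of d] assms(2) dvd_imp_le_int[of d "int N"] by auto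

text \<open>Frequencies that differ by less than \<open>N\<close> are not aliased by sampling at the
  \<open>N\<close>-th roots of unity, so only the diagonal terms of the expanded square
  survive.\<close>

lemma parseval_roots:
  fixes c :: "int \<Rightarrow> complex"
  assumes N: "0 < N" and Q: "finite Q" and diff: "\<And>a b. a \<in> Q \<Longrightarrow> b \<in> Q \<Longrightarrow> \<bar>a - b\<bar> < int N"
  shows "(\<Sum>j<N. (cmod (\<Sum>a\<in>Q. c a * cis (- (of_int a * (2 * pi * real j / real N)))))\<^sup>2)
    = real N * (\<Sum>a\<in>Q. (cmod (c a))\<^sup>2)"
proof -
  let ?\<omega> = "\<lambda>j. 2 * pi * real j / real N"
  have "complex_of_real (\<Sum>j<N. (cmod (\<Sum>a\<in>Q. c a * cis (- (of_int a * ?\<omega> j))))\<^sup>2)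
      = (\<Sum>j<N. \<Sum>a\<in>Q. \<Sum>b\<in>Q. c a * cnj (c b) * cis (of_int (b - a) * ?\<omega> j))"
    unfolding of_real_sum complex_norm_square cnj_sum sum_product
  proof (intro sum.cong refl)
    fix j a b
    have "cis (of_int (b - a) * ?\<omega> j) = cis (- (of_int a * ?\<omega> j)) * cnj (cis (- (of_int b * ?\<omega> j)))"
      unfolding cis_cnj cis_mult by (simp add: left_diff_distrib diff_divide_distrib)
    then show "c a * cis (- (of_int a * ?\<omega> j)) * cnj (c b * cis (- (of_int b * ?\<omega> j)))
        = c a * cnj (c b) * cis (of_int (b - a) * ?\<omega> j)"
      by simp
  qed
  also have "\<dots> = (\<Sum>a\<in>Q. \<Sum>b\<in>Q. c a * cnj (c b) * (\<Sum>j<N. cis (of_int (b - a) * ?\<omega> j)))"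
    unfolding sum_distrib_left by (subst sum.swap, intro sum.cong refl, subst sum.swap) auto
  also have "\<dots> = (\<Sum>a\<in>Q. \<Sum>b\<in>Q. if b = a then c a * cnj (c b) * of_nat N else 0)"
    using diff N by (intro sum.cong refl, subst sum_cis_roots_less) auto
  also have "\<dots> = (\<Sum>a\<in>Q. of_nat N * complex_of_real ((cmod (c a))\<^sup>2))"
    using Q by (simp add: mult.commute[of _ "of_nat N"] flip: complex_norm_square)
  also have "\<dots> = complex_of_real (real N * (\<Sum>a\<in>Q. (cmod (c a))\<^sup>2))"
    by (simp add: sum_distrib_left)
  finally show ?thesis by (simp only: of_real_eq_iff)
qed

text \<open>A chord of the unit circle has length \<open>2 * \<bar>sin (y / 2)\<bar>\<close> and is
  no longer than its arc.\<close>

lemma cmod_cis_minus_one_le: "cmod (cis y - 1) \<le> \<bar>y\<bar>"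
proof -
  have "(cmod (cis y - 1))\<^sup>2 = (2 * sin (y / 2))\<^sup>2"
  proof -
    have "(cmod (cis y - 1))\<^sup>2 = (sin y)\<^sup>2 + (cos y)\<^sup>2 + 1 - 2 * cos y"
      by (simp add: cmod_power2 power2_diff)
    also have "\<dots> = 2 - 2 * cos (2 * (y / 2))" by simp
    also have "\<dots> = (2 * sin (y / 2))\<^sup>2" unfolding cos_double_sin by (simp add: power_mult_distrib)
    finally show ?thesis .
  qed
  also have "\<dots> \<le> y\<^sup>2"
    using abs_sin_x_le_abs_x[of "y / 2"] by (intro abs_le_square_iff[THEN iffD1]) simp
  finally show ?thesis by (metis abs_le_square_iff abs_norm_cancel)
qed

text \<open>Cauchy-Schwarz with squared norms, so that values from Parseval's identity can be
  inserted without square roots.\<close>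

lemma sum_cmod_mult_le:
  fixes x y :: "'i \<Rightarrow> complex"
  assumes "(\<Sum>j\<in>J. (cmod (x j))\<^sup>2) * (\<Sum>j\<in>J. (cmod (y j))\<^sup>2) \<le> K\<^sup>2" "0 \<le> K"
  shows "(\<Sum>j\<in>J. cmod (x j * y j)) \<le> K"
proof -
  have "(\<Sum>j\<in>J. cmod (x j) * cmod (y j))\<^sup>2 \<le> K\<^sup>2"
    using Cauchy_Schwarz_ineq_sum assms(1) by (rule order_trans)
  then show ?thesis unfolding norm_mult using assms(2) by (rule power2_le_imp_le)
qed

text \<open>The weights come from a de la Vallee Poussin kernel sampled at the \<open>3 L\<close>-th roots of unity:
  \<open>V \<tau>\<close> reproduces the value at \<open>\<tau>\<close> of every trigonometric polynomial of degree at most \<open>L\<close>.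
  Its factorisation \<open>V = A B / L\<close> reduces the bound on the total variation of
  \<open>V \<tau> - V 0\<close> to Parseval's identity.\<close>

lemma exists_sine_moment_matching:
  assumes L: "0 < L" and \<tau>: "0 \<le> \<tau>"
  obtains w :: "nat \<Rightarrow> real" where "(\<Sum>j<3 * L. \<bar>w j\<bar>) \<le> 6 * real L * \<tau>"
    "\<And>l. l \<le> L \<Longrightarrow> (\<Sum>j<3 * L. w j * sin (2 * pi * real j / real (3 * L)) ^ l) = sin \<tau> ^ l - 0 ^ l"
proof -
  define N where "N = 3 * L"
  have N: "0 < N" using L by (simp add: N_def)
  define \<omega> where "\<omega> j = 2 * pi * real j / real N" for j
  \<comment> \<open>For \<open>\<bar>s\<bar> \<le> L\<close> and every \<open>a\<close> in
    \<open>Qa\<close>, the number \<open>s - a\<close> lies in \<open>Qb\<close>. Hence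
    \<open>s\<close> is a sum \<open>a + b\<close> in exactly \<open>L\<close> ways, and the
    coefficient of frequency \<open>s\<close> in \<open>A * B / L\<close> is 1.\<close>
  define Qa where "Qa = {0..<int L}"
  define Qb where "Qb = {- 2 * int L + 1..int L}"
  define A where "A \<sigma> j = (\<Sum>a\<in>Qa. cis (of_int a * \<sigma>) * cis (- (of_int a * \<omega> j)))" for \<sigma> j
  define B where "B \<sigma> j = (\<Sum>b\<in>Qb. cis (of_int b * \<sigma>) * cis (- (of_int b * \<omega> j)))" for \<sigma> j
  define V where "V \<sigma> j = A \<sigma> j * B \<sigma> j / of_nat L" for \<sigma> j
  note orth = sum_cis_roots_less[OF N, folded \<omega>_def]
  have reproduce: "(\<Sum>j<N. V \<sigma> j * cis (of_int s * \<omega> j)) = of_nat N * cis (of_int s * \<sigma>)"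
    if s: "\<bar>s\<bar> \<le> int L" for s \<sigma>
  proof -
    have "(\<Sum>j<N. V \<sigma> j * cis (of_int s * \<omega> j)) = (\<Sum>j<N. \<Sum>a\<in>Qa. \<Sum>b\<in>Qb.
        cis (of_int (a + b) * \<sigma>) * cis (of_int (s - a - b) * \<omega> j) / of_nat L)"
      unfolding V_def A_def B_def sum_product
      unfolding sum_divide_distrib sum_distrib_right
    proof (intro sum.cong refl)
      fix j a b
      have "cis (of_int (a + b) * \<sigma>) = cis (of_int a * \<sigma>) * cis (of_int b * \<sigma>)"
        by (simp add: cis_mult distrib_right)
      moreover have "cis (of_int (s - a - b) * \<omega> j)
          = cis (of_int s * \<omega> j) * (cis (- (of_int a * \<omega> j)) * cis (- (of_int b * \<omega> j)))"
        by (simp add: cis_mult algebra_simps)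
      ultimately show "cis (of_int a * \<sigma>) * cis (- (of_int a * \<omega> j)) * (cis (of_int b * \<sigma>) * cis (- (of_int b * \<omega> j)))
          / of_nat L * cis (of_int s * \<omega> j)
        = cis (of_int (a + b) * \<sigma>) * cis (of_int (s - a - b) * \<omega> j) / of_nat L"
        by simp
    qed
    also have "\<dots> = (\<Sum>a\<in>Qa. \<Sum>b\<in>Qb. cis (of_int (a + b) * \<sigma>) / of_nat L * (\<Sum>j<N. cis (of_int (s - a - b) * \<omega> j)))"
      unfolding sum_distrib_left by (subst sum.swap, intro sum.cong refl, subst sum.swap) auto
    also have "\<dots> = (\<Sum>a\<in>Qa. \<Sum>b\<in>Qb. if b = s - a then cis (of_int s * \<sigma>) / of_nat L * of_nat N else 0)"
      using s by (intro sum.cong refl, subst orth) (auto simp: Qa_def Qb_def N_def)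
    also have "\<dots> = (\<Sum>a\<in>Qa. cis (of_int s * \<sigma>) / of_nat L * of_nat N)"
      using s by (intro sum.cong refl, subst sum.delta) (auto simp: Qa_def Qb_def)
    also have "\<dots> = of_nat N * cis (of_int s * \<sigma>)"
      using L by (simp add: Qa_def)
    finally show ?thesis .
  qed
  \<comment> \<open>Euler's formula trades one factor \<open>sin\<close> for the shifts
    \<open>s + 1\<close> and \<open>s - 1\<close>. The induction therefore needs the extra frequency
    \<open>s\<close>, with \<open>\<bar>s\<bar> + l\<close> kept at most \<open>L\<close>.\<close>
  have moments: "(\<Sum>j<N. V \<sigma> j * (of_real (sin (\<omega> j)) ^ l * cis (of_int s * \<omega> j)))
      = of_nat N * (of_real (sin \<sigma>) ^ l * cis (of_int s * \<sigma>))"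
    if "\<bar>s\<bar> + int l \<le> int L" for s \<sigma> l
    using that
  proof (induction l arbitrary: s)
    case 0
    then show ?case using reproduce[of s \<sigma>] by simp
  next
    case (Suc l)
    have step: "of_real (sin x) ^ Suc l * cis (of_int s * x)
        = (of_real (sin x) ^ l * cis (of_int (s + 1) * x) - of_real (sin x) ^ l * cis (of_int (s - 1) * x)) / (2 * \<i>)" for x
    proof -
      have "of_real (sin x) = (cis x - cis (- x)) / (2 * \<i>)"
        by (simp add: complex_eq_iff)
      then have "of_real (sin x) * cis (of_int s * x) = (cis (of_int (s + 1) * x) - cis (of_int (s - 1) * x)) / (2 * \<i>)"
        by (simp add: left_diff_distrib cis_mult distrib_right add.commute)
      then have "of_real (sin x) ^ l * (of_real (sin x) * cis (of_int s * x))
        = of_real (sin x) ^ l * ((cis (of_int (s + 1) * x) - cis (of_int (s - 1) * x)) / (2 * \<i>))" by simp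
      then show ?thesis by (simp only: power_Suc mult_ac right_diff_distrib times_divide_eq_right)
    qed
    have "\<bar>s + 1\<bar> + int l \<le> int L" "\<bar>s - 1\<bar> + int l \<le> int L" using Suc.prems by auto
    note IH = this[THEN Suc.IH]
    show ?case
      unfolding step right_diff_distrib times_divide_eq_right
      by (simp only: sum_subtractf IH flip: sum_divide_distrib)
  qed
  \<comment> \<open>Taking real parts preserves the moment identities because the nodes and the
    targets are real.\<close>
  define w where "w j = Re ((V \<tau> j - V 0 j) / of_nat N)" for j
  have "(\<Sum>j<N. w j * sin (\<omega> j) ^ l) = sin \<tau> ^ l - 0 ^ l" if "l \<le> L" for l
  proof -
    have "(\<Sum>j<N. w j * sin (\<omega> j) ^ l)
        = Re (\<Sum>j<N. (V \<tau> j - V 0 j) / of_nat N * of_real (sin (\<omega> j)) ^ l)"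
      by (simp add: w_def flip: of_real_power)
    also have "(\<Sum>j<N. (V \<tau> j - V 0 j) / of_nat N * of_real (sin (\<omega> j)) ^ l)
      = ((\<Sum>j<N. V \<tau> j * (of_real (sin (\<omega> j)) ^ l * cis (of_int 0 * \<omega> j)))
        - (\<Sum>j<N. V 0 j * (of_real (sin (\<omega> j)) ^ l * cis (of_int 0 * \<omega> j)))) / of_nat N"
      by (simp add: sum_subtractf left_diff_distrib diff_divide_distrib flip: sum_divide_distrib)
    also have "\<dots> = of_real (sin \<tau>) ^ l - of_real (sin 0) ^ l"
      using that N by (subst (1 2) moments) (auto simp: diff_divide_distrib)
    also have "\<dots> = of_real (sin \<tau> ^ l - 0 ^ l)" by simp
    finally show ?thesis by simp
  qed
  moreover have "(\<Sum>j<N. \<bar>w j\<bar>) \<le> 6 * real L * \<tau>"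
  proof -
    have PA: "(\<Sum>j<N. (cmod (\<Sum>a\<in>Qa. c a * cis (- (of_int a * \<omega> j))))\<^sup>2) = real N * (\<Sum>a\<in>Qa. (cmod (c a))\<^sup>2)" for c
      unfolding \<omega>_def using N by (rule parseval_roots) (auto simp: Qa_def N_def)
    have PB: "(\<Sum>j<N. (cmod (\<Sum>b\<in>Qb. c b * cis (- (of_int b * \<omega> j))))\<^sup>2) = real N * (\<Sum>b\<in>Qb. (cmod (c b))\<^sup>2)" for c
      unfolding \<omega>_def using N by (rule parseval_roots) (auto simp: Qb_def N_def)
    have lip: "(cmod (cis (of_int a * \<tau>) - 1))\<^sup>2 \<le> (K * \<tau>)\<^sup>2" if "\<bar>of_int a\<bar> \<le> K" for a :: int and K
    proof (rule power_mono)
      have "cmod (cis (of_int a * \<tau>) - 1) \<le> \<bar>of_int a * \<tau>\<bar>" by (rule cmod_cis_minus_one_le)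
      also have "\<dots> \<le> K * \<tau>" using that \<tau> by (auto simp: abs_mult intro: mult_right_mono)
      finally show "cmod (cis (of_int a * \<tau>) - 1) \<le> K * \<tau>" .
    qed simp
    have A2: "(\<Sum>j<N. (cmod (A 0 j))\<^sup>2) = real N * real L"
      unfolding A_def PA by (simp add: Qa_def)
    have B2: "(\<Sum>j<N. (cmod (B \<tau> j))\<^sup>2) = real N * (3 * real L)"
      unfolding B_def PB by (simp add: Qb_def)
    have dA2: "(\<Sum>j<N. (cmod (A \<tau> j - A 0 j))\<^sup>2) \<le> real N * (real L * (real L * \<tau>)\<^sup>2)"
    proof -
      have "A \<tau> j - A 0 j = (\<Sum>a\<in>Qa. (cis (of_int a * \<tau>) - 1) * cis (- (of_int a * \<omega> j)))" for j
        by (simp add: A_def sum_subtractf left_diff_distrib)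
      then have "(\<Sum>j<N. (cmod (A \<tau> j - A 0 j))\<^sup>2) = real N * (\<Sum>a\<in>Qa. (cmod (cis (of_int a * \<tau>) - 1))\<^sup>2)"
        by (simp only: PA)
      also have "(\<Sum>a\<in>Qa. (cmod (cis (of_int a * \<tau>) - 1))\<^sup>2) \<le> (\<Sum>a\<in>Qa. (real L * \<tau>)\<^sup>2)"
        by (intro sum_mono lip) (auto simp: Qa_def)
      also have "\<dots> = real L * (real L * \<tau>)\<^sup>2" by (simp add: Qa_def)
      finally show ?thesis using N by simp
    qed
    have dB2: "(\<Sum>j<N. (cmod (B \<tau> j - B 0 j))\<^sup>2) \<le> real N * (3 * real L * (2 * real L * \<tau>)\<^sup>2)"
    proof -
      have "B \<tau> j - B 0 j = (\<Sum>a\<in>Qb. (cis (of_int a * \<tau>) - 1) * cis (- (of_int a * \<omega> j)))" for j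
        by (simp add: B_def sum_subtractf left_diff_distrib)
      then have "(\<Sum>j<N. (cmod (B \<tau> j - B 0 j))\<^sup>2) = real N * (\<Sum>a\<in>Qb. (cmod (cis (of_int a * \<tau>) - 1))\<^sup>2)"
        by (simp only: PB)
      also have "(\<Sum>a\<in>Qb. (cmod (cis (of_int a * \<tau>) - 1))\<^sup>2) \<le> (\<Sum>a\<in>Qb. (2 * real L * \<tau>)\<^sup>2)"
      proof (intro sum_mono lip)
        fix a assume "a \<in> Qb"
        then have "\<bar>a\<bar> \<le> 2 * int L" by (auto simp: Qb_def)
        then show "\<bar>real_of_int a\<bar> \<le> 2 * real L" by linarith
      qed
      also have "\<dots> = 3 * real L * (2 * real L * \<tau>)\<^sup>2" by (simp add: Qb_def)
      finally show ?thesis using N by simp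
    qed
    \<comment> \<open>The factors 2 here and 4 in the next bound are integer upper bounds for the
      square roots of 3 and 12.\<close>
    have 1: "(\<Sum>j<N. cmod ((A \<tau> j - A 0 j) * B \<tau> j)) \<le> 2 * (real N * (real L)\<^sup>2 * \<tau>)"
    proof (rule sum_cmod_mult_le)
      have "(\<Sum>j<N. (cmod (A \<tau> j - A 0 j))\<^sup>2) * (\<Sum>j<N. (cmod (B \<tau> j))\<^sup>2)
          \<le> real N * (real L * (real L * \<tau>)\<^sup>2) * (real N * (3 * real L))"
        unfolding B2 by (intro mult_right_mono dA2) simp
      also have "\<dots> = 3 * (real N * (real L)\<^sup>2 * \<tau>)\<^sup>2" by (simp add: power2_eq_square)
      also have "\<dots> \<le> (2 * (real N * (real L)\<^sup>2 * \<tau>))\<^sup>2" by (simp add: power_mult_distrib)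
      finally show "(\<Sum>j<N. (cmod (A \<tau> j - A 0 j))\<^sup>2) * (\<Sum>j<N. (cmod (B \<tau> j))\<^sup>2)
          \<le> (2 * (real N * (real L)\<^sup>2 * \<tau>))\<^sup>2" .
    qed (use \<tau> in simp)
    have 2: "(\<Sum>j<N. cmod (A 0 j * (B \<tau> j - B 0 j))) \<le> 4 * (real N * (real L)\<^sup>2 * \<tau>)"
    proof (rule sum_cmod_mult_le)
      have "(\<Sum>j<N. (cmod (A 0 j))\<^sup>2) * (\<Sum>j<N. (cmod (B \<tau> j - B 0 j))\<^sup>2)
          \<le> real N * real L * (real N * (3 * real L * (2 * real L * \<tau>)\<^sup>2))"
        unfolding A2 by (intro mult_left_mono dB2) simp
      also have "\<dots> = 12 * (real N * (real L)\<^sup>2 * \<tau>)\<^sup>2" by (simp add: power2_eq_square)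
      also have "\<dots> \<le> (4 * (real N * (real L)\<^sup>2 * \<tau>))\<^sup>2" by (simp add: power_mult_distrib)
      finally show "(\<Sum>j<N. (cmod (A 0 j))\<^sup>2) * (\<Sum>j<N. (cmod (B \<tau> j - B 0 j))\<^sup>2)
          \<le> (4 * (real N * (real L)\<^sup>2 * \<tau>))\<^sup>2" .
    qed (use \<tau> in simp)
    \<comment> \<open>The difference of the two products \<open>A * B\<close> is telescoped,
      changing one factor at a time.\<close>
    have "\<bar>w j\<bar> \<le> (cmod ((A \<tau> j - A 0 j) * B \<tau> j) + cmod (A 0 j * (B \<tau> j - B 0 j))) / (real L * real N)" for j
    proof -
      have "(V \<tau> j - V 0 j) / of_nat N = ((A \<tau> j - A 0 j) * B \<tau> j + A 0 j * (B \<tau> j - B 0 j)) / (of_nat L * of_nat N)"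
        by (simp add: V_def diff_divide_distrib add_divide_distrib algebra_simps)
      then have "\<bar>w j\<bar> \<le> cmod (((A \<tau> j - A 0 j) * B \<tau> j + A 0 j * (B \<tau> j - B 0 j)) / (of_nat L * of_nat N))"
        unfolding w_def by (metis abs_Re_le_cmod)
      also have "\<dots> = cmod ((A \<tau> j - A 0 j) * B \<tau> j + A 0 j * (B \<tau> j - B 0 j)) / (real L * real N)"
        by (simp add: norm_divide norm_mult)
      also have "\<dots> \<le> (cmod ((A \<tau> j - A 0 j) * B \<tau> j) + cmod (A 0 j * (B \<tau> j - B 0 j))) / (real L * real N)"
        by (intro divide_right_mono norm_triangle_ineq) simp
      finally show ?thesis .
    qed
    then have "(\<Sum>j<N. \<bar>w j\<bar>) \<le> (\<Sum>j<N. (cmod ((A \<tau> j - A 0 j) * B \<tau> j) + cmod (A 0 j * (B \<tau> j - B 0 j))) / (real L * real N))"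
      by (intro sum_mono)
    also have "\<dots> = ((\<Sum>j<N. cmod ((A \<tau> j - A 0 j) * B \<tau> j)) + (\<Sum>j<N. cmod (A 0 j * (B \<tau> j - B 0 j)))) / (real L * real N)"
      by (simp only: sum.distrib flip: sum_divide_distrib)
    also have "\<dots> \<le> (2 * (real N * (real L)\<^sup>2 * \<tau>) + 4 * (real N * (real L)\<^sup>2 * \<tau>)) / (real L * real N)"
      using 1 2 by (intro divide_right_mono add_mono) auto
    also have "\<dots> = 6 * real L * \<tau>" using N L by (simp add: field_simps power2_eq_square)
    finally show ?thesis .
  qed
  ultimately show ?thesis using that[of w] unfolding N_def \<omega>_def by blast
qed

section \<open>Decay of the chi-square form under matching moments\<close>

lemma power_div_fact_le: "(real l / 6) ^ l / fact l \<le> (1 / 2) ^ l"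
proof -
  \<comment> \<open>One term of the exponential series at \<open>l\<close> is at most the whole sum,
    and \<open>e < 3\<close> is half of 6.\<close>
  have "real l ^ l / fact l \<le> (\<Sum>m. real l ^ m / fact m)"
    using summable_exp[of "real l"]
    by (intro order_trans[OF _ sum_le_suminf[of _ "{l}"]]) (auto simp: field_simps)
  also have "\<dots> = exp (real l)" by (simp add: exp_def field_simps)
  also have "\<dots> = exp 1 ^ l" by (simp flip: exp_of_nat_mult)
  also have "\<dots> \<le> 3 ^ l" using e_less_272 by (intro power_mono) auto
  finally have "real l ^ l / fact l / 6 ^ l \<le> 3 ^ l / 6 ^ l" by (intro divide_right_mono) auto
  also have "(3 :: real) ^ l / 6 ^ l = (3 / 6) ^ l" by (rule power_divide[symmetric])
  finally show ?thesis by (simp add: power_divide field_simps)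
qed

text \<open>Expanding \<open>exp (u i * u j)\<close> diagonalises the form into squared moments
  divided by factorials. The terms up to order \<open>L\<close> vanish, and the size of
  \<open>M\<close> makes the rest a geometric tail of ratio 1/2.\<close>

lemma exp_quadratic_form_le:
  fixes c u :: "'i \<Rightarrow> real"
  assumes fin: "finite I" and zero: "\<And>l. l \<le> L \<Longrightarrow> (\<Sum>i\<in>I. c i * u i ^ l) = 0"
    and bound: "\<And>l. L < l \<Longrightarrow> \<bar>\<Sum>i\<in>I. c i * u i ^ l\<bar> \<le> K * M ^ l" and M: "M\<^sup>2 \<le> real L / 6"
  shows "(\<Sum>i\<in>I. \<Sum>j\<in>I. c i * c j * exp (u i * u j)) \<le> K\<^sup>2 * (1 / 2) ^ L"
proof -
  define m where "m l = (\<Sum>i\<in>I. c i * u i ^ l)" for l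
  have "(\<lambda>l. \<Sum>i\<in>I. \<Sum>j\<in>I. c i * c j * ((u i * u j) ^ l / fact l))
      sums (\<Sum>i\<in>I. \<Sum>j\<in>I. c i * c j * exp (u i * u j))"
    using exp_converges[where 'a=real] by (intro sums_sum sums_mult) (simp add: scaleR_conv_of_real divide_inverse mult.commute)
  also have "(\<lambda>l. \<Sum>i\<in>I. \<Sum>j\<in>I. c i * c j * ((u i * u j) ^ l / fact l)) = (\<lambda>l. (m l)\<^sup>2 / fact l)"
    by (simp add: m_def power2_eq_square sum_product sum_divide_distrib power_mult_distrib mult_ac)
  finally have sums: "(\<lambda>l. (m l)\<^sup>2 / fact l) sums (\<Sum>i\<in>I. \<Sum>j\<in>I. c i * c j * exp (u i * u j))" .
  have "(m l)\<^sup>2 / fact l = 0" if "l < Suc L" for l using zero[of l] that by (simp add: m_def)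
  then have sums': "(\<lambda>l. (m (l + Suc L))\<^sup>2 / fact (l + Suc L)) sums (\<Sum>i\<in>I. \<Sum>j\<in>I. c i * c j * exp (u i * u j))"
    using sums sums_zero_iff_shift[of "Suc L" "\<lambda>l. (m l)\<^sup>2 / fact l"] by blast
  have geo: "(\<lambda>l. K\<^sup>2 * (1 / 2) ^ Suc L * (1 / 2 :: real) ^ l) sums (K\<^sup>2 * (1 / 2) ^ Suc L * (1 / (1 - 1 / 2)))"
    by (intro sums_mult geometric_sums) simp
  have "(m (l + Suc L))\<^sup>2 / fact (l + Suc L) \<le> K\<^sup>2 * (1 / 2) ^ Suc L * (1 / 2) ^ l" for l
  proof -
    define r where "r = l + Suc L"
    have "\<bar>m r\<bar> ^ 2 \<le> (K * M ^ r)\<^sup>2"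
      unfolding m_def by (intro power_mono bound) (auto simp: r_def)
    also have "\<dots> = K\<^sup>2 * (M\<^sup>2) ^ r" by (simp add: power_mult_distrib power_even_eq flip: power_mult)
    also have "\<dots> \<le> K\<^sup>2 * (real r / 6) ^ r"
      using M by (intro mult_left_mono power_mono) (auto simp: r_def)
    finally have "(m r)\<^sup>2 / fact r \<le> K\<^sup>2 * (real r / 6) ^ r / fact r"
      by (intro divide_right_mono) auto
    also have "\<dots> = K\<^sup>2 * ((real r / 6) ^ r / fact r)" by simp
    also have "\<dots> \<le> K\<^sup>2 * (1 / 2) ^ r" by (intro mult_left_mono power_div_fact_le) simp
    finally show ?thesis by (simp add: r_def power_add mult_ac)
  qed
  then show ?thesis using sums_le[OF _ sums' geo] by simp
qed

section \<open>The lower bound\<close>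

text \<open>By the mean value theorem, since \<open>cos\<close> is at least 1/2 on
  \<open>[0, pi / 3]\<close>, which contains \<open>[0, 1]\<close>.\<close>

lemma half_le_sin:
  fixes y :: real
  assumes "0 \<le> y" "y \<le> 1"
  shows "y / 2 \<le> sin y"
proof (cases "y = 0")
  case False
  then have y: "0 < y" using assms by simp
  have "\<exists>z. z > 0 \<and> z < y \<and> sin y - sin 0 = (y - 0) * cos z"
    using y by (intro MVT2) (auto intro: DERIV_sin)
  then obtain z where z: "0 < z" "z < y" "sin y = y * cos z" by auto
  have "cos (pi / 3) \<le> cos z"
    using z assms pi_gt3 by (intro cos_monotone_0_pi_le) auto
  then have "y * (1 / 2) \<le> y * cos z" using y by (intro mult_left_mono) (auto simp: cos_60)
  then show ?thesis using z by simp
qed simp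

text \<open>The priors differ by \<open>\<beta>\<close> times \<open>delta_t - delta_0 - w\<close>,
  where \<open>t = M * sin \<tau>\<close> and \<open>w\<close> sits on the scaled sine nodes. The
  positive part of \<open>w\<close> goes into \<open>p\<close> and the negative part into
  \<open>q\<close>, which keeps both nonnegative while the moments up to order \<open>L\<close>
  cancel.\<close>

lemma risk_ge_moment_matching:
  assumes \<epsilon>: "0 \<le> \<epsilon>" "\<epsilon> \<le> 1 / 2" and L: "0 < L" and h: "0 \<le> h"
    and chernoff: "7 * (1 + \<epsilon> * h) ^ n \<le> (1 + h) ^ k"
    and small: "72 * (real n * \<epsilon>\<^sup>2 * (1 - 2 * \<epsilon>)\<^sup>2) \<le> 2 ^ L / 64"
    and r: "2 * r < sqrt (real L / 6) * sin (\<epsilon> / (3 * real L))"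
    and T: "T \<in> borel_measurable (lborel_pow n)"
  shows "1 / 4 \<le> risk n k T r"
proof -
  define N where "N = 3 * L"
  define M where "M = sqrt (real L / 6)"
  \<comment> \<open>This choice turns the variation bound \<open>6 * L * \<tau>\<close> into
    \<open>2 * \<epsilon>\<close>.\<close>
  define \<tau> where "\<tau> = \<epsilon> / (3 * real L)"
  have M: "0 \<le> M" "M\<^sup>2 = real L / 6" by (auto simp: M_def)
  have \<tau>: "0 \<le> \<tau>" "\<tau> \<le> \<epsilon>"
    using \<epsilon> L by (auto simp: \<tau>_def divide_le_eq mult_le_cancel_left1)
  have sin_nonneg: "0 \<le> sin \<tau>" using \<tau> \<epsilon> pi_gt3 by (intro sin_ge_zero) auto
  have sin_le: "sin \<tau> \<le> \<epsilon>" using sin_x_le_x[OF \<tau>(1)] \<tau>(2) by simp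
  obtain w :: "nat \<Rightarrow> real" where w_abs: "(\<Sum>j<N. \<bar>w j\<bar>) \<le> 6 * real L * \<tau>"
    and w_moment: "\<And>l. l \<le> L \<Longrightarrow> (\<Sum>j<N. w j * sin (2 * pi * real j / real N) ^ l) = sin \<tau> ^ l - 0 ^ l"
    by (rule exists_sine_moment_matching[OF L \<tau>(1), folded N_def]) (rule that, assumption, blast)
  have w_abs: "(\<Sum>j<N. \<bar>w j\<bar>) \<le> 2 * \<epsilon>" using w_abs L by (simp add: \<tau>_def)
  have w_sum: "(\<Sum>j<N. w j) = 0" using w_moment[of 0] by simp
  define B where "B = (\<Sum>j<N. max (w j) 0)"
  have "(\<Sum>j<N. max (w j) 0) - (\<Sum>j<N. max (- w j) 0) = (\<Sum>j<N. w j)"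
    unfolding sum_subtractf[symmetric] by (intro sum.cong) auto
  then have B_neg: "(\<Sum>j<N. max (- w j) 0) = B" using w_sum by (simp add: B_def)
  have "(\<Sum>j<N. max (w j) 0) + (\<Sum>j<N. max (- w j) 0) = (\<Sum>j<N. \<bar>w j\<bar>)"
    unfolding sum.distrib[symmetric] by (intro sum.cong) auto
  then have B: "0 \<le> B" "B \<le> \<epsilon>" using w_abs B_neg by (auto simp: B_def intro!: sum_nonneg)
  \<comment> \<open>Both priors contaminate with total mass \<open>\<beta> * B + \<rho>\<close>;
    \<open>\<beta>\<close> and \<open>\<rho>\<close> are chosen to make it equal to
    \<open>\<epsilon>\<close>. That \<open>\<rho>\<close> is nonnegative comes from
    \<open>(1 - \<epsilon>)^2 \<ge> 1 - 2 * \<epsilon>\<close> and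
    \<open>B \<le> \<epsilon>\<close>.\<close>
  define \<beta> where "\<beta> = (1 - 2 * \<epsilon>) / (1 - B)"
  define \<rho> where "\<rho> = 1 - \<epsilon> - \<beta>"
  have \<beta>0: "0 \<le> \<beta>" unfolding \<beta>_def using \<epsilon> B by auto
  have \<beta>2: "\<beta> \<le> 2 * (1 - 2 * \<epsilon>)"
  proof -
    have "\<beta> \<le> (1 - 2 * \<epsilon>) / (1 / 2)" unfolding \<beta>_def using \<epsilon> B by (intro divide_left_mono) auto
    then show ?thesis by simp
  qed
  have \<beta>B: "\<beta> * B = \<beta> - (1 - 2 * \<epsilon>)"
    unfolding \<beta>_def using \<epsilon> B by (simp add: field_simps)
  have "\<beta> \<le> 1 - \<epsilon>"
  proof -
    have "1 - 2 * \<epsilon> \<le> (1 - \<epsilon>) * (1 - \<epsilon>)" by (simp add: algebra_simps)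
    also have "\<dots> \<le> (1 - \<epsilon>) * (1 - B)" using \<epsilon> B by (intro mult_left_mono) auto
    finally show ?thesis unfolding \<beta>_def using \<epsilon> B by (simp add: divide_le_eq)
  qed
  then have \<rho>0: "0 \<le> \<rho>" by (simp add: \<rho>_def)
  \<comment> \<open>Indices below \<open>N\<close> are the sine nodes, \<open>N\<close> is the
    alternative mean \<open>t\<close>, and \<open>Suc N\<close> is the mean 0.\<close>
  define u where "u i = (if i < N then M * sin (2 * pi * real i / real N) else if i = N then M * sin \<tau> else 0)" for i
  define p where "p i = (if i < N then \<beta> * max (w i) 0 else if i = N then \<rho> else 1 - \<epsilon>)" for i
  define q where "q i = (if i < N then \<beta> * max (- w i) 0 else if i = N then 1 - \<epsilon> else \<rho>)" for i
  let ?I = "{..<Suc (Suc N)}"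
  have sumI: "sum f ?I = sum f {..<N} + f N + f (Suc N)" for f :: "nat \<Rightarrow> real" by simp
  have p0: "0 \<le> p i" and q0: "0 \<le> q i" for i
    using \<beta>0 \<rho>0 \<epsilon> by (auto simp: p_def q_def)
  have psum: "sum p ?I = 1" and qsum: "sum q ?I = 1"
    unfolding sumI using \<beta>B B_neg
    by (simp_all add: p_def q_def \<rho>_def B_def[symmetric] flip: sum_distrib_left)
  have moment: "(\<Sum>i\<in>?I. (q i - p i) * u i ^ l)
      = \<beta> * (M ^ l * (sin \<tau> ^ l - (\<Sum>j<N. w j * sin (2 * pi * real j / real N) ^ l)) - 0 ^ l)" for l
  proof -
    have "(\<Sum>i<N. (q i - p i) * u i ^ l) = (\<Sum>i<N. - (\<beta> * M ^ l) * (w i * sin (2 * pi * real i / real N) ^ l))"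
      by (intro sum.cong refl) (auto simp: q_def p_def u_def power_mult_distrib max_def)
    also have "\<dots> = - (\<beta> * M ^ l) * (\<Sum>i<N. w i * sin (2 * pi * real i / real N) ^ l)"
      by (rule sum_distrib_left[symmetric])
    finally show ?thesis
      unfolding sumI by (simp add: q_def p_def u_def \<rho>_def power_mult_distrib algebra_simps)
  qed
  have "(\<Sum>i\<in>?I. \<Sum>j\<in>?I. (q i - p i) * (q j - p j) * exp (u i * u j)) \<le> (\<beta> * (3 * \<epsilon>))\<^sup>2 * (1 / 2) ^ L"
  proof (rule exp_quadratic_form_le)
    fix l assume l: "l \<le> L"
    show "(\<Sum>i\<in>?I. (q i - p i) * u i ^ l) = 0"
      unfolding moment w_moment[OF l] by (simp add: power_0_left)
  next
    fix l assume l: "L < l"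
    let ?s = "\<Sum>j<N. w j * sin (2 * pi * real j / real N) ^ l"
    have "\<bar>?s\<bar> \<le> (\<Sum>j<N. \<bar>w j\<bar> * 1)"
    proof (intro order_trans[OF sum_abs] sum_mono)
      fix j
      have "\<bar>sin (2 * pi * real j / real N)\<bar> ^ l \<le> 1" by (intro power_le_one) auto
      then show "\<bar>w j * sin (2 * pi * real j / real N) ^ l\<bar> \<le> \<bar>w j\<bar> * 1"
        unfolding abs_mult power_abs by (intro mult_left_mono) auto
    qed
    moreover have "sin \<tau> ^ l \<le> sin \<tau> ^ 1"
      using l sin_nonneg by (intro power_decreasing) auto
    moreover have "0 \<le> sin \<tau> ^ l" using sin_nonneg by simp
    \<comment> \<open>The variation of \<open>w\<close> contributes \<open>2 * \<epsilon>\<close>,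
      and \<open>sin \<tau>\<close> another \<open>\<epsilon>\<close>.\<close>
    ultimately have "\<bar>sin \<tau> ^ l - ?s\<bar> \<le> 3 * \<epsilon>" using w_abs sin_le by simp
    then have "\<beta> * (M ^ l * \<bar>sin \<tau> ^ l - ?s\<bar>) \<le> \<beta> * (M ^ l * (3 * \<epsilon>))"
      using \<beta>0 M by (intro mult_left_mono) auto
    then show "\<bar>\<Sum>i\<in>?I. (q i - p i) * u i ^ l\<bar> \<le> \<beta> * (3 * \<epsilon>) * M ^ l"
      unfolding moment using l \<beta>0 M by (simp add: abs_mult power_0_left mult_ac)
  qed (use M in auto)
  also have "(\<beta> * (3 * \<epsilon>))\<^sup>2 * (1 / 2) ^ L \<le> (2 * (1 - 2 * \<epsilon>) * (3 * \<epsilon>))\<^sup>2 * (1 / 2) ^ L"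
    using \<beta>0 \<beta>2 \<epsilon> by (intro mult_right_mono power_mono) auto
  also have "\<dots> = 36 * (\<epsilon>\<^sup>2 * (1 - 2 * \<epsilon>)\<^sup>2) / 2 ^ L"
    unfolding power_mult_distrib power_divide by simp
  finally have "real n * (2 * (\<Sum>i\<in>?I. \<Sum>j\<in>?I. (q i - p i) * (q j - p j) * exp (u i * u j)))
      \<le> real n * (2 * (36 * (\<epsilon>\<^sup>2 * (1 - 2 * \<epsilon>)\<^sup>2) / 2 ^ L))"
    by (intro mult_left_mono) auto
  also have "\<dots> = 72 * (real n * \<epsilon>\<^sup>2 * (1 - 2 * \<epsilon>)\<^sup>2) / 2 ^ L" by simp
  also have "\<dots> \<le> 2 ^ L / 64 / 2 ^ L" using small by (intro divide_right_mono) auto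
  finally have chi: "real n * (2 * (\<Sum>i\<in>?I. \<Sum>j\<in>?I. (q i - p i) * (q j - p j) * exp (u i * u j))) \<le> 1 / 64"
    by simp
  \<comment> \<open>Only an inclusion holds: some sine nodes, such as the one of index 0, lie at 0
    themselves.\<close>
  have "sum p {i \<in> ?I. u i \<noteq> 0} \<le> sum p (?I - {Suc N})"
    using p0 by (intro sum_mono2) (auto simp: u_def)
  also have "\<dots> = \<epsilon>" using psum by (subst sum_diff1) (auto simp: p_def)
  finally have pcont: "sum p {i \<in> ?I. u i \<noteq> 0} \<le> \<epsilon>" .
  have "sum q {i \<in> ?I. u i \<noteq> M * sin \<tau>} \<le> sum q (?I - {N})"
    using q0 by (intro sum_mono2) (auto simp: u_def)
  also have "\<dots> = \<epsilon>" using qsum by (subst sum_diff1) (auto simp: q_def)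
  finally have qcont: "sum q {i \<in> ?I. u i \<noteq> M * sin \<tau>} \<le> \<epsilon>" .
  show ?thesis
  proof (rule risk_ge_two_mixtures[where I = "?I" and p = p and q = q and u = u and ?i0.0 = "Suc N"
        and t = "M * sin \<tau>", OF _ p0 psum q0 qsum _ _ _ pcont qcont h chernoff chi _ T])
    show "2 * r < M * sin \<tau>" using r by (simp add: M_def \<tau>_def)
    show "1 / 2 \<le> p (Suc N)" using \<epsilon> by (simp add: p_def)
  qed (simp_all add: u_def)
qed

section \<open>Parametric regime and large-signal regime\<close>

lemma risk_ge_parametric:
  assumes n: "0 < n" and k: "1 \<le> k" and r: "2 * r < 1 / (16 * sqrt (real n))"
    and T: "T \<in> borel_measurable (lborel_pow n)"
  shows "1 / 4 \<le> risk n k T r"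
proof -
  \<comment> \<open>The chi-square bound for two shifted Gaussians is at most
    \<open>4 * n * t^2\<close>, which this \<open>t\<close> makes equal to 1/64.\<close>
  define t where "t = 1 / (16 * sqrt (real n))"
  have t2: "t\<^sup>2 = 1 / (256 * real n)" by (simp add: t_def power_divide power_mult_distrib)
  have "t\<^sup>2 \<le> 1 / 2" unfolding t2 using n by (simp add: field_simps)
  then have "exp (t\<^sup>2) \<le> 1 + 2 * t\<^sup>2" by (intro real_exp_bound_lemma) auto
  then have "real n * (2 * (exp (t\<^sup>2) - 1)) \<le> real n * (2 * (2 * t\<^sup>2))"
    by (intro mult_left_mono) auto
  also have "\<dots> = 1 / 64" unfolding t2 using n by simp
  finally have chi: "real n * (2 * (exp (t\<^sup>2) - 1)) \<le> 1 / 64" .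
  have pow: "(7 :: real) ^ 1 \<le> 7 ^ k" using k by (intro power_increasing) auto
  show ?thesis
    \<comment> \<open>Two point masses need no contamination. With \<open>\<epsilon> = 0\<close> and
      \<open>h = 6\<close> the Chernoff condition is just \<open>7 \<le> 7 ^ k\<close>.\<close>
    by (rule risk_ge_two_mixtures[where I = "UNIV :: bool set" and p = "\<lambda>b. of_bool (\<not> b)"
          and q = of_bool and u = "\<lambda>b. if b then t else 0" and ?i0.0 = False and t = t
          and \<epsilon> = 0 and h = 6])
      (use chi pow r T in \<open>auto simp: UNIV_bool t_def power2_eq_square Collect_conv_if\<close>)
qed

text \<open>This is \<open>n * \<epsilon>^2 * (1 - 2 * \<epsilon>)^2\<close> at
  \<open>\<epsilon> = k / n\<close>, the scale of the chi-square distance of the sample before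
  moment matching.\<close>

definition signal :: "nat \<Rightarrow> nat \<Rightarrow> real" where
  "signal n k = (real k)\<^sup>2 * (real n - 2 * real k)\<^sup>2 / (real n) ^ 3"

definition rate :: "nat \<Rightarrow> nat \<Rightarrow> real" where
  "rate n k = real k / real n * ln (1 + signal n k) powr (- 1 / 2)"

lemma ln_one_plus_ge_sixth:
  fixes x :: real
  assumes "1 / 5 \<le> x"
  shows "1 / 6 \<le> ln (1 + x)"
proof -
  have "ln (1 / (1 + x)) \<le> 1 / (1 + x) - 1" using assms by (intro ln_le_minus_one) auto
  moreover have "1 / (1 + x) \<le> 5 / 6" using assms by (simp add: field_simps)
  ultimately show ?thesis using assms by (simp add: ln_div)
qed

lemma rate_eq:
  assumes "0 < signal n k"
  shows "rate n k = real k / (real n * sqrt (ln (1 + signal n k)))"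
  using assms by (simp add: rate_def powr_minus powr_half_sqrt powr_divide field_simps)

lemma signal_pos:
  assumes "1 \<le> k" "real k \<le> real n / 2 - sqrt (real n)"
  shows "0 < signal n k"
proof -
  have n: "0 < real n" using assms by (cases "n = 0") auto
  then have "0 < real n - 2 * real k" using assms(2) real_sqrt_gt_zero[OF n] by linarith
  then show ?thesis using assms n by (simp add: signal_def)
qed

text \<open>For a small signal the logarithm is comparable to the signal itself, of order
  \<open>k^2 / n\<close>, and \<open>k\<close> cancels. Otherwise \<open>k\<close> is bounded and
  the logarithm is bounded below, so the rate is even of order \<open>1 / n\<close>.\<close>

lemma rate_le_parametric:
  assumes k: "1 \<le> k" "real k \<le> real n / 2 - sqrt (real n)" and small: "signal n k < 1 / 5 \<or> k < 64"
  shows "rate n k \<le> 160 / sqrt (real n)"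
proof -
  define x where "x = signal n k"
  have n: "0 < real n" using k by (cases "n = 0") auto
  have x: "0 < x" unfolding x_def using k by (rule signal_pos)
  have sn: "sqrt (real n) * sqrt (real n) = real n" by simp
  have gap: "2 * sqrt (real n) \<le> real n - 2 * real k" using k by simp
  show ?thesis
  proof (cases "x < 1 / 5")
    case True
    \<comment> \<open>For \<open>k \<ge> n / 4\<close> the gap
      \<open>n - 2 * k \<ge> 2 * sqrt n\<close> alone would push the signal up to 1/4.\<close>
    have k4: "real k < real n / 4"
    proof (rule ccontr)
      assume "\<not> real k < real n / 4"
      then have "(real n / 4)\<^sup>2 * (2 * sqrt (real n))\<^sup>2 \<le> (real k)\<^sup>2 * (real n - 2 * real k)\<^sup>2"
        using gap n by (intro mult_mono power_mono) auto
      then have "(real n / 4)\<^sup>2 * (2 * sqrt (real n))\<^sup>2 / real n ^ 3 \<le> x"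
        unfolding x_def signal_def using n by (intro divide_right_mono) auto
      also have "(real n / 4)\<^sup>2 * (2 * sqrt (real n))\<^sup>2 / real n ^ 3 = 1 / 4"
        using n by (simp add: power_mult_distrib power_divide power2_eq_square power3_eq_cube)
      finally show False using True by simp
    qed
    have "(real k)\<^sup>2 * (real n / 2)\<^sup>2 / real n ^ 3 \<le> x"
      unfolding x_def signal_def using n k4 by (intro divide_right_mono mult_left_mono power_mono) auto
    also have "(real k)\<^sup>2 * (real n / 2)\<^sup>2 / real n ^ 3 = (real k)\<^sup>2 / (4 * real n)"
      using n by (simp add: power_divide power2_eq_square power3_eq_cube)
    finally have xk: "(real k)\<^sup>2 / (4 * real n) \<le> x" .
    have "x / 2 \<le> ln (1 + x)"
    proof -
      have "ln (1 / (1 + x)) \<le> 1 / (1 + x) - 1" using x by (intro ln_le_minus_one) auto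
      then have "1 - 1 / (1 + x) \<le> ln (1 + x)" using x by (simp add: ln_div)
      moreover have "x / 2 \<le> 1 - 1 / (1 + x)" using x True by (simp add: field_simps mult_left_le)
      ultimately show ?thesis by simp
    qed
    with xk have "(real k)\<^sup>2 / (8 * real n) \<le> ln (1 + x)" by simp
    moreover have "(real k / (3 * sqrt (real n)))\<^sup>2 \<le> (real k)\<^sup>2 / (8 * real n)"
      using n by (simp add: power_divide power_mult_distrib field_simps)
    ultimately have "real k / (3 * sqrt (real n)) \<le> sqrt (ln (1 + x))"
      by (intro real_le_rsqrt) linarith
    then have "real k / (real n * sqrt (ln (1 + x))) \<le> real k / (real n * (real k / (3 * sqrt (real n))))"
      using n k x by (intro divide_left_mono mult_left_mono) auto
    also have "\<dots> = 3 / sqrt (real n)" using n k sn by (simp add: field_simps)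
    also have "\<dots> \<le> 160 / sqrt (real n)" using n by (intro divide_right_mono) auto
    finally show ?thesis using rate_eq[of n k] x by (simp add: x_def)
  next
    case False
    then have k64: "real k \<le> 64" using small by (simp add: x_def)
    have "(2 / 5 :: real)\<^sup>2 \<le> ln (1 + x)"
      using ln_one_plus_ge_sixth[of x] False by (simp add: power2_eq_square)
    then have "2 / 5 \<le> sqrt (ln (1 + x))" by (rule real_le_rsqrt)
    then have "real k / (real n * sqrt (ln (1 + x))) \<le> 64 / (real n * (2 / 5))"
      using n k64 by (intro frac_le mult_left_mono) auto
    also have "\<dots> = 160 / real n" by simp
    also have "\<dots> \<le> 160 / sqrt (real n)"
    proof (intro divide_left_mono)
      have "1 \<le> real n" using n by simp
      then show "sqrt (real n) \<le> real n" using real_sqrt_le_mono[of "real n" "(real n)\<^sup>2"]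
        by (simp add: power2_eq_square)
    qed (use n in auto)
    finally show ?thesis using rate_eq[of n k] x by (simp add: x_def)
  qed
qed

text \<open>Lowering the expected number of contaminated coordinates from \<open>k\<close> to \<open>k - 4 sqrt k\<close> makes
  Chernoff's bound available; since \<open>n - 2 k \<ge> 2 sqrt n\<close>, it changes \<open>n - 2 k\<close> by a constant factor only.\<close>

lemma risk_ge_large_signal:
  assumes k: "64 \<le> k" "real k \<le> real n / 2 - sqrt (real n)" and x: "1 / 5 \<le> signal n k"
    and T: "T \<in> borel_measurable (lborel_pow n)"
  shows "1 / 4 \<le> risk n k T (1 / 10000 * rate n k)"
proof -
  define x where "x = signal n k"
  define s where "s = sqrt (real k)"
  have s: "8 \<le> s" unfolding s_def using k(1) by (intro real_le_rsqrt) simp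
  have k_eq: "real k = s * s" by (simp add: s_def)
  have n: "0 < real n" using k by (cases "n = 0") auto
  have kn: "real k \<le> real n / 2" using k n real_sqrt_ge_zero[of "real n"] by linarith
  have x5: "1 / 5 \<le> x" using x by (simp add: x_def)
  define \<epsilon> where "\<epsilon> = (real k - 4 * s) / real n"
  \<comment> \<open>With this \<open>h\<close> the two exponents in the Chernoff condition are
    \<open>2 * s - 8\<close> and at least \<open>2 * s - 4\<close>; the difference 4 absorbs the
    factor 7.\<close>
  define h where "h = 2 / s"
  \<comment> \<open>The factor \<open>2 ^ 17\<close> pays for the chi-square constants:
    \<open>2 ^ 17 / 64 = 2048\<close> exceeds \<open>72 * 25\<close>. Rounding up keeps
    \<open>L\<close> within a constant multiple of \<open>ln (1 + x)\<close>, because that logarithm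
    is at least 1/6.\<close>
  define L where "L = nat \<lceil>log 2 (2 ^ 17 * (1 + x))\<rceil>"
  have half: "real k / 2 \<le> real k - 4 * s" unfolding k_eq using s by (simp add: field_simps)
  then have \<epsilon>_ge: "real k / (2 * real n) \<le> \<epsilon>"
    unfolding \<epsilon>_def using n by (simp add: field_simps)
  have \<epsilon>_le: "\<epsilon> \<le> real k / real n"
    unfolding \<epsilon>_def using n s by (intro divide_right_mono) auto
  also have "\<dots> \<le> 1 / 2" using kn n by (simp add: field_simps)
  finally have \<epsilon>_half: "\<epsilon> \<le> 1 / 2" .
  have \<epsilon>0: "0 \<le> \<epsilon>" using \<epsilon>_ge n by (meson divide_nonneg_nonneg of_nat_0_le_iff order_trans mult_nonneg_nonneg zero_le_numeral)
  have "17 \<le> log 2 (2 ^ 17 * (1 + x))"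
    using x5 by (simp add: le_log_iff powr_realpow)
  then have L0: "0 < L" unfolding L_def by linarith
  have "log 2 (2 ^ 17 * (1 + x)) \<le> real L" unfolding L_def by linarith
  then have "2 ^ 17 * (1 + x) \<le> 2 powr real L" using x5 by (subst (asm) log_le_iff) auto
  then have L_ge: "2 ^ 17 * (1 + x) \<le> 2 ^ L" by (simp add: powr_realpow)
  have L_le: "real L \<le> 110 * ln (1 + x)"
  proof -
    have ln6: "1 / 6 \<le> ln (1 + x)" using x5 by (rule ln_one_plus_ge_sixth)
    have "real L \<le> log 2 (2 ^ 17 * (1 + x)) + 1"
      unfolding L_def using \<open>17 \<le> log 2 (2 ^ 17 * (1 + x))\<close> by linarith
    also have "log 2 (2 ^ 17 * (1 + x)) = 17 + ln (1 + x) / ln 2"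
    proof -
      have "log 2 (2 ^ 17 * (1 + x)) = log 2 (2 ^ 17) + log 2 (1 + x)"
        using x5 by (intro log_mult_pos) auto
      also have "log 2 (2 ^ 17 :: real) = 17" by (subst log_pow_cancel) auto
      finally show ?thesis by (simp add: log_def)
    qed
    also have "ln (1 + x) / ln 2 \<le> ln (1 + x) / (1 / 2)"
      using ln6 ln2_ge_two_thirds by (intro divide_left_mono) auto
    finally show ?thesis using ln6 by simp
  qed
  have chernoff: "7 * (1 + \<epsilon> * h) ^ n \<le> (1 + h) ^ k"
  proof -
    have "(1 + \<epsilon> * h) ^ n \<le> exp (\<epsilon> * h) ^ n"
      using \<epsilon>0 s by (intro power_mono) (auto simp: h_def)
    also have "\<dots> = exp (real n * (\<epsilon> * h))" by (simp add: exp_of_nat_mult)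
    also have "real n * (\<epsilon> * h) = 2 * s - 8"
      using n s by (simp add: \<epsilon>_def h_def k_eq field_simps)
    finally have 1: "(1 + \<epsilon> * h) ^ n \<le> exp (2 * s - 8)" .
    have "2 * s - 4 = real k * (h - h\<^sup>2)"
      using s by (simp add: h_def k_eq field_simps power2_eq_square)
    also have "\<dots> \<le> real k * ln (1 + h)"
      using s by (intro mult_left_mono ln_one_plus_pos_lower_bound) (auto simp: h_def)
    finally have "exp (2 * s - 4) \<le> exp (real k * ln (1 + h))" by simp
    also have "\<dots> = (1 + h) ^ k" using s by (simp add: exp_of_nat_mult h_def add_pos_pos)
    finally have 2: "exp (2 * s - 4) \<le> (1 + h) ^ k" .
    have "(7 :: real) \<le> 2 ^ 4" by simp
    also have "\<dots> \<le> exp 1 ^ 4" using exp_ge_add_one_self[of "1 :: real"] by (intro power_mono) auto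
    also have "\<dots> = exp 4" by (simp flip: exp_of_nat_mult)
    finally have "7 * exp (2 * s - 8) \<le> exp 4 * exp (2 * s - 8)" by (intro mult_right_mono) auto
    also have "\<dots> = exp (2 * s - 4)" by (simp flip: exp_add)
    finally show ?thesis using 1 2 by linarith
  qed
  have small: "72 * (real n * \<epsilon>\<^sup>2 * (1 - 2 * \<epsilon>)\<^sup>2) \<le> 2 ^ L / 64"
  proof -
    have "s \<le> sqrt (real n)" unfolding s_def using kn n by (intro real_sqrt_le_mono) auto
    \<comment> \<open>The added \<open>8 * s\<close> is at most \<open>8 * sqrt n\<close>, hence at
      most \<open>4 * (n - 2 * k)\<close>.\<close>
    then have gap: "real n - 2 * (real k - 4 * s) \<le> 5 * (real n - 2 * real k)"
      using k(2) by (simp add: algebra_simps)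
    have gap0: "0 \<le> real n - 2 * (real k - 4 * s)" using kn s by (simp add: algebra_simps)
    have "real n * \<epsilon>\<^sup>2 * (1 - 2 * \<epsilon>)\<^sup>2 = (real k - 4 * s)\<^sup>2 * (real n - 2 * (real k - 4 * s))\<^sup>2 / real n ^ 3"
    proof -
      have "1 - 2 * \<epsilon> = (real n - 2 * (real k - 4 * s)) / real n" using n by (simp add: \<epsilon>_def field_simps)
      then show ?thesis using n by (simp add: \<epsilon>_def power_divide power2_eq_square power3_eq_cube)
    qed
    also have "\<dots> \<le> (real k)\<^sup>2 * (5 * (real n - 2 * real k))\<^sup>2 / real n ^ 3"
      using n s half gap gap0 by (intro divide_right_mono mult_mono power_mono) auto
    also have "\<dots> = 25 * x" unfolding x_def signal_def power_mult_distrib by simp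
    finally have "72 * (real n * \<epsilon>\<^sup>2 * (1 - 2 * \<epsilon>)\<^sup>2) \<le> 72 * (25 * x)" by simp
    also have "\<dots> \<le> 2 ^ 17 * (1 + x) / 64" using x5 by simp
    also have "\<dots> \<le> 2 ^ L / 64" using L_ge by simp
    finally show ?thesis .
  qed
  \<comment> \<open>The separation is of order \<open>\<epsilon> / sqrt L\<close>. Halving
    \<open>k\<close>, bounding \<open>sqrt L\<close> by \<open>11 * l\<close> and the losses in
    \<open>sin\<close> and \<open>sqrt 6\<close> give the constant \<open>396 = 2 * 18 * 11\<close>,
    well below 5000.\<close>
  have "2 * (1 / 10000 * rate n k) < sqrt (real L / 6) * sin (\<epsilon> / (3 * real L))"
  proof -
    define l where "l = sqrt (ln (1 + x))"
    have l: "0 < l" using x5 by (simp add: l_def)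
    have L1: "1 \<le> real L" using L0 by simp
    have y: "0 \<le> \<epsilon> / (3 * real L)" "\<epsilon> / (3 * real L) \<le> 1"
      using \<epsilon>0 \<epsilon>_half L1 by (auto simp: divide_le_eq)
    have sqL: "0 < sqrt (real L)" "sqrt (real L) * sqrt (real L) = real L" using L1 by auto
    have "sqrt (real L) \<le> sqrt (110 * ln (1 + x))" using L_le by (rule real_sqrt_le_mono)
    also have "\<dots> = sqrt 110 * l" by (simp add: l_def real_sqrt_mult)
    also have "\<dots> \<le> 11 * l" using l by (intro mult_right_mono real_le_lsqrt) auto
    finally have sqL_le: "sqrt (real L) \<le> 11 * l" .
    have s6: "sqrt 6 \<le> 3" by (rule real_le_lsqrt) auto
    have "2 * (1 / 10000 * rate n k) = real k / (5000 * (real n * l))"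
      using rate_eq[of n k] x5 by (simp add: x_def l_def)
    also have "\<dots> < real k / (396 * (real n * l))"
      using n l k by (intro divide_strict_left_mono mult_strict_right_mono) auto
    also have "\<dots> = real k / (2 * real n) / (18 * (11 * l))" by simp
    also have "\<dots> \<le> \<epsilon> / (18 * sqrt (real L))"
      using \<epsilon>_ge \<epsilon>0 sqL sqL_le n by (intro frac_le) auto
    also have "\<dots> = sqrt (real L) / 3 * (\<epsilon> / (3 * real L) / 2)"
    proof -
      have "\<epsilon> / (18 * a) = a / 3 * (\<epsilon> / (3 * (a * a)) / 2)" if "0 < a" for a
        using that by (simp add: field_simps)
      from this[OF sqL(1)] show ?thesis unfolding sqL(2) .
    qed
    also have "\<dots> \<le> sqrt (real L / 6) * sin (\<epsilon> / (3 * real L))"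
    proof (rule mult_mono)
      show "sqrt (real L) / 3 \<le> sqrt (real L / 6)"
        unfolding real_sqrt_divide using s6 sqL by (intro divide_left_mono) auto
    qed (use y half_le_sin[OF y] in auto)
    finally show ?thesis .
  qed
  then show ?thesis
    using s by (intro risk_ge_moment_matching[OF \<epsilon>0 \<epsilon>_half L0 _ chernoff small _ T]) (auto simp: h_def)
qed

theorem mainTheorem6:
  shows "\<exists>C c :: real. C > 0 \<and> c > 0 \<and>
    (\<forall>n k :: nat. n \<ge> 2 \<longrightarrow> 1 \<le> k \<longrightarrow> real k \<le> real n / 2 - sqrt (real n) \<longrightarrow>
      (\<forall>\<theta>hat \<in> borel_measurable (PiM {..<n} (\<lambda>_. borel)).
         (SUP p \<in> {(\<theta>, \<gamma>) | \<theta> \<gamma>. l0norm n \<gamma> \<le> k}.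
            measure (obs_law n (fst p) (snd p))
              {x \<in> space (obs_law n (fst p) (snd p)).
                 \<bar>\<theta>hat x - fst p\<bar> > C * (real k / real n) *
                   ln (1 + (real k)^2 * (real n - 2 * real k)^2 / (real n)^3) powr (-1/2)})
         \<ge> c))"
proof (rule exI[of _ "1 / 10000"], rule exI[of _ "1 / 4"], intro conjI allI impI ballI)
  fix n k :: nat and T :: "(nat \<Rightarrow> real) \<Rightarrow> real"
  assume n: "n \<ge> 2" and k: "1 \<le> k" "real k \<le> real n / 2 - sqrt (real n)"
    and "T \<in> borel_measurable (PiM {..<n} (\<lambda>_. borel))"
  moreover have "sets (PiM {..<n} (\<lambda>_. borel :: real measure)) = sets (lborel_pow n)"
    by (intro sets_PiM_cong) auto
  ultimately have T: "T \<in> borel_measurable (lborel_pow n)"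
    using measurable_cong_sets by blast
  have "1 / 4 \<le> risk n k T (1 / 10000 * rate n k)"
  proof (cases "signal n k < 1 / 5 \<or> k < 64")
    case True
    \<comment> \<open>Here \<open>2 * 160 / 10000 = 0.032\<close> is below \<open>1 / 16\<close>,
      the separation of the two uncontaminated Gaussians in units of
      \<open>1 / sqrt n\<close>.\<close>
    have "2 * (1 / 10000 * rate n k) \<le> 2 * (1 / 10000 * (160 / sqrt (real n)))"
      using rate_le_parametric[OF k True] by simp
    also have "\<dots> < 1 / (16 * sqrt (real n))" using n by (simp add: field_simps)
    finally show ?thesis using n k T by (intro risk_ge_parametric) auto
  next
    case False
    then show ?thesis using k T by (intro risk_ge_large_signal) auto
  qed
  then show "(SUP p \<in> {(\<theta>, \<gamma>) | \<theta> \<gamma>. l0norm n \<gamma> \<le> k}.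
            measure (obs_law n (fst p) (snd p))
              {x \<in> space (obs_law n (fst p) (snd p)).
                 \<bar>T x - fst p\<bar> > 1 / 10000 * (real k / real n) *
                   ln (1 + (real k)^2 * (real n - 2 * real k)^2 / (real n)^3) powr (-1/2)}) \<ge> 1 / 4"
    unfolding risk_def rate_def signal_def by (simp only: mult.assoc)
qed simp_all

end
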